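(* Let $K$ be a field of characteristic $0$, let $E$ be the (infinite-dimensional, unitary) Grassmann algebra over $K$ with even part $E_0$, and let \[A=\begin{pmatrix} E_0 & E\\ 0 & E\end{pmatrix}.\] Let $n\geq 1$ be an even number and let $F_n(A)=K\langle x_1,\dots,x_n\rangle/(K\langle x_1,\dots,x_n\rangle\cap T(A))$ be the relatively free algebra of rank $n$ of the variety generated by $A$. Then the T-ideal $T(F_n(A))$ of polynomial identities of $F_n(A)$ is generated (as a T-ideal of $K\langle X\rangle$) by \[[x_1,x_2][x_3,x_4,x_5]\quad\text{and}\quad [x_1,x_2][x_3,x_4]\cdots[x_{n+3},x_{n+4}].\] Moreover, $T(F_n(A))=T(F_{n+1}(A))$.
   Context: All algebras are associative and unitary over $K$. $K\langle X\rangle$ is the free unitary associative algebra on $X=\{x_1,x_2,\dots\}$. For an algebra $R$, $T(R)$ is the ideal of all polynomials of $K\langle X\rangle$ that are polynomial identities of $R$. The Grassmann algebra $E$ is generated by $e_1,e_2,\dots$ subject to $e_ie_j=-e_je_i$; it has basis $1$ and the products $e_{i_1}\cdots e_{i_k}$ with $i_1<\dots<i_k$, and $E_0$ (resp. $E_1$) is the span of those basis products of even (resp. odd) length. Commutators are $[a,b]=ab-ba$ and $[a_1,\dots,a_k]=[[a_1,\dots,a_{k-1}],a_k]$. A T-ideal is an ideal invariant under all endomorphisms of $K\langle X\rangle$; the T-ideal generated by a set $S$ is the smallest T-ideal containing $S$. *)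

theory Defs
  imports Main "HOL-Library.List_Lexorder"
begin

record ('a, 'k) alg =
  acar  :: "'a set"
  aadd  :: "'a \<Rightarrow> 'a \<Rightarrow> 'a"
  azero :: "'a"
  amul  :: "'a \<Rightarrow> 'a \<Rightarrow> 'a"
  aone  :: "'a"
  asmul :: "'k \<Rightarrow> 'a \<Rightarrow> 'a"

text \<open>A polynomial is a finitely supported function from words (lists of variable
  indices) to coefficients.\<close>

definition polys :: "(nat list \<Rightarrow> 'k::zero) set" where
  "polys = {f. finite {w. f w \<noteq> 0}}"

definition padd :: "(nat list \<Rightarrow> 'k::plus) \<Rightarrow> (nat list \<Rightarrow> 'k) \<Rightarrow> nat list \<Rightarrow> 'k" where
  "padd f g = (\<lambda>w. f w + g w)"

definition psub :: "(nat list \<Rightarrow> 'k::minus) \<Rightarrow> (nat list \<Rightarrow> 'k) \<Rightarrow> nat list \<Rightarrow> 'k" where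
  "psub f g = (\<lambda>w. f w - g w)"

definition pzero :: "nat list \<Rightarrow> 'k::zero" where
  "pzero = (\<lambda>w. 0)"

definition pone :: "nat list \<Rightarrow> 'k::{zero,one}" where
  "pone = (\<lambda>w. if w = [] then 1 else 0)"

definition psmul :: "'k::times \<Rightarrow> (nat list \<Rightarrow> 'k) \<Rightarrow> nat list \<Rightarrow> 'k" where
  "psmul c f = (\<lambda>w. c * f w)"

text \<open>Product: concatenation of words, extended bilinearly.\<close>
definition pmul :: "(nat list \<Rightarrow> 'k::comm_semiring_1) \<Rightarrow> (nat list \<Rightarrow> 'k) \<Rightarrow> nat list \<Rightarrow> 'k" where
  "pmul f g = (\<lambda>w. \<Sum>i\<in>{0..length w}. f (take i w) * g (drop i w))"

definition pvar :: "nat \<Rightarrow> nat list \<Rightarrow> 'k::{zero,one}" where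
  "pvar i = (\<lambda>w. if w = [i] then 1 else 0)"

definition free_alg :: "(nat list \<Rightarrow> 'k::comm_ring_1, 'k) alg" where
  "free_alg = \<lparr> acar = polys, aadd = padd, azero = pzero, amul = pmul,
                aone = pone, asmul = psmul \<rparr>"

definition mono_eval :: "('a, 'k) alg \<Rightarrow> (nat \<Rightarrow> 'a) \<Rightarrow> nat list \<Rightarrow> 'a" where
  "mono_eval R \<phi> w = foldr (\<lambda>i acc. amul R (\<phi> i) acc) w (aone R)"

definition alg_eval :: "('a, 'k::zero) alg \<Rightarrow> (nat list \<Rightarrow> 'k) \<Rightarrow> (nat \<Rightarrow> 'a) \<Rightarrow> 'a" where
  "alg_eval R f \<phi> =
     foldr (\<lambda>w acc. aadd R (asmul R (f w) (mono_eval R \<phi> w)) acc)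
           (sorted_list_of_set {w. f w \<noteq> 0}) (azero R)"

definition subst :: "(nat list \<Rightarrow> 'k::comm_ring_1) \<Rightarrow> (nat \<Rightarrow> nat list \<Rightarrow> 'k) \<Rightarrow> nat list \<Rightarrow> 'k" where
  "subst f \<phi> = alg_eval free_alg f \<phi>"

definition Tid :: "('a, 'k::zero) alg \<Rightarrow> (nat list \<Rightarrow> 'k) set" where
  "Tid R = {f \<in> polys. \<forall>\<phi>. (\<forall>i. \<phi> i \<in> acar R) \<longrightarrow> alg_eval R f \<phi> = azero R}"

definition is_ideal :: "(nat list \<Rightarrow> 'k::comm_ring_1) set \<Rightarrow> bool" where
  "is_ideal I \<longleftrightarrow> I \<subseteq> polys \<and> pzero \<in> I \<and>
     (\<forall>f\<in>I. \<forall>g\<in>I. padd f g \<in> I) \<and>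
     (\<forall>f\<in>I. \<forall>h\<in>polys. pmul h f \<in> I \<and> pmul f h \<in> I)"

definition is_T_ideal :: "(nat list \<Rightarrow> 'k::comm_ring_1) set \<Rightarrow> bool" where
  "is_T_ideal I \<longleftrightarrow> is_ideal I \<and>
     (\<forall>f\<in>I. \<forall>\<phi>. (\<forall>i. \<phi> i \<in> polys) \<longrightarrow> subst f \<phi> \<in> I)"

definition T_gen :: "(nat list \<Rightarrow> 'k::comm_ring_1) set \<Rightarrow> (nat list \<Rightarrow> 'k) set" where
  "T_gen S = \<Inter>{I. is_T_ideal I \<and> S \<subseteq> I}"

definition pcomm :: "(nat list \<Rightarrow> 'k::comm_ring_1) \<Rightarrow> (nat list \<Rightarrow> 'k) \<Rightarrow> nat list \<Rightarrow> 'k" where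
  "pcomm f g = psub (pmul f g) (pmul g f)"

text \<open>[x_1,x_2][x_3,x_4,x_5] (paper's x_j is pvar (j-1)).\<close>
definition gen1 :: "nat list \<Rightarrow> 'k::comm_ring_1" where
  "gen1 = pmul (pcomm (pvar 0) (pvar 1)) (pcomm (pcomm (pvar 2) (pvar 3)) (pvar 4))"

definition gen2 :: "nat \<Rightarrow> nat list \<Rightarrow> 'k::comm_ring_1" where
  "gen2 n = foldr (\<lambda>j acc. pmul (pcomm (pvar (2*j)) (pvar (2*j+1))) acc)
                  [0..<n div 2 + 2] pone"

text \<open>An element is a finitely supported function from finite sets of generator
  indices S = {i_1 < ... < i_k} (standing for e_{i_1}...e_{i_k}) to K.\<close>

definition grass :: "(nat set \<Rightarrow> 'k::zero) set" where
  "grass = {a. finite {S. a S \<noteq> 0} \<and> (\<forall>S. a S \<noteq> 0 \<longrightarrow> finite S)}"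

definition grass0 :: "(nat set \<Rightarrow> 'k::zero) set" where
  "grass0 = {a \<in> grass. \<forall>S. a S \<noteq> 0 \<longrightarrow> even (card S)}"

text \<open>Sign of reordering e_U e_V into increasing order.\<close>
definition gsign :: "nat set \<Rightarrow> nat set \<Rightarrow> 'k::comm_ring_1" where
  "gsign U V = (-1) ^ card {(u, v). u \<in> U \<and> v \<in> V \<and> v < u}"

definition gmul :: "(nat set \<Rightarrow> 'k::comm_ring_1) \<Rightarrow> (nat set \<Rightarrow> 'k) \<Rightarrow> nat set \<Rightarrow> 'k" where
  "gmul a b = (\<lambda>S. \<Sum>U\<in>{U. a U \<noteq> 0}. \<Sum>V\<in>{V. b V \<noteq> 0}.
      if U \<inter> V = {} \<and> U \<union> V = S then gsign U V * a U * b V else 0)"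

definition gadd :: "(nat set \<Rightarrow> 'k::plus) \<Rightarrow> (nat set \<Rightarrow> 'k) \<Rightarrow> nat set \<Rightarrow> 'k" where
  "gadd a b = (\<lambda>S. a S + b S)"

definition gzero :: "nat set \<Rightarrow> 'k::zero" where
  "gzero = (\<lambda>S. 0)"

definition gone :: "nat set \<Rightarrow> 'k::{zero,one}" where
  "gone = (\<lambda>S. if S = {} then 1 else 0)"

definition gsmul :: "'k::times \<Rightarrow> (nat set \<Rightarrow> 'k) \<Rightarrow> nat set \<Rightarrow> 'k" where
  "gsmul c a = (\<lambda>S. c * a S)"

text \<open>The upper triangular matrix [[a, b], [0, d]] is represented by the triple (a, b, d).\<close>

type_synonym 'k grel = "nat set \<Rightarrow> 'k"

definition A_alg :: "('k::comm_ring_1 grel \<times> 'k grel \<times> 'k grel, 'k) alg" where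
  "A_alg = \<lparr>
     acar = {(a, b, d). a \<in> grass0 \<and> b \<in> grass \<and> d \<in> grass},
     aadd = (\<lambda>(a, b, d) (a', b', d'). (gadd a a', gadd b b', gadd d d')),
     azero = (gzero, gzero, gzero),
     amul = (\<lambda>(a, b, d) (a', b', d'). (gmul a a', gadd (gmul a b') (gmul b d'), gmul d d')),
     aone = (gone, gzero, gone),
     asmul = (\<lambda>c (a, b, d). (gsmul c a, gsmul c b, gsmul c d)) \<rparr>"

definition polys_n :: "nat \<Rightarrow> (nat list \<Rightarrow> 'k::zero) set" where
  "polys_n n = {f \<in> polys. \<forall>w. f w \<noteq> 0 \<longrightarrow> (\<forall>i\<in>set w. i < n)}"

definition relfree :: "('a, 'k::comm_ring_1) alg \<Rightarrow> nat \<Rightarrow> ((nat list \<Rightarrow> 'k) set, 'k) alg" where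
  "relfree R n = (let J = polys_n n \<inter> Tid R;
                      cls = (\<lambda>g. {h \<in> polys_n n. psub h g \<in> J}) in
     \<lparr> acar = cls ` polys_n n,
       aadd = (\<lambda>c d. {h \<in> polys_n n. \<exists>a\<in>c. \<exists>b\<in>d. psub h (padd a b) \<in> J}),
       azero = cls pzero,
       amul = (\<lambda>c d. {h \<in> polys_n n. \<exists>a\<in>c. \<exists>b\<in>d. psub h (pmul a b) \<in> J}),
       aone = cls pone,
       asmul = (\<lambda>k c. {h \<in> polys_n n. \<exists>a\<in>c. psub h (psmul k a) \<in> J}) \<rparr>)"

end

theory Submission
  imports Defs "HOL-Library.Multiset"
begin

text \<open>
  Let \<open>C\<close> be the commutator ideal of the free algebra and \<open>J\<close> the ideal of triple commutators. A product
  of \<open>n/2 + 2\<close> commutators vanishes on every subalgebra of \<open>A\<close> generated by \<open>n + 1\<close> elements: all factors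
  but the first contribute through the lower right corner, where they are products of pairs of odd
  elements taken from a span of \<open>n + 1\<close> odd elements over the even part.

  Conversely, let \<open>f\<close> be an identity of \<open>F\<^sub>n(A)\<close>. Suitable \<open>n\<close> matrices generate a subalgebra containing all
  \<open>(a, \<delta>, \<xi> + \<theta>)\<close> with \<open>a\<close>, \<open>\<xi>\<close> scalars, \<open>\<delta>\<close> zero or one, and \<open>\<theta>\<close> zero or one of the generators
  \<open>e\<^sub>0, \<dots>, e\<^sub>n\<^sub>-\<^sub>1\<close>. Replacing prefixes of words by sorted words telescopes, and since \<open>f\<close> vanishes on scalars
  it becomes a sum of terms \<open>(u\<^sub>\<alpha> x\<^sub>i - u\<^sub>\<alpha>\<^sub>+\<^sub>i) D\<^sub>\<alpha>\<^sub>,\<^sub>i f\<close> with the first factor in \<open>C\<close> and \<open>D\<close> a Fox derivative. The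
  upper right corner of the evaluation shows that each \<open>D\<^sub>\<alpha>\<^sub>,\<^sub>i f\<close> vanishes at all \<open>\<xi> + \<theta>\<close>, and this
  forces it into \<open>J + C\<^sup>m\<close> with \<open>m = n/2 + 1\<close>. Finally \<open>C (J + C\<^sup>m)\<close> lies in the T-ideal generated by the two
  polynomials, because \<open>[b, c] d = [b, c d] - c [b, d]\<close>.
\<close>

section \<open>The free algebra as a ring type\<close>

lemma pmul_Nil: "pmul f g [] = f [] * g []"
  by (simp add: pmul_def)

text \<open>Splitting off the first letter turns the sum over cut points into a recursion on the
  word, which drives the inductions for associativity and the right unit law.\<close>

lemma pmul_Cons: "pmul f g (x # w) = f [] * g (x # w) + pmul (\<lambda>v. f (x # v)) g w"
  by (simp add: pmul_def sum.atLeast0_atMost_Suc_shift del: sum.cl_ivl_Suc)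

lemma pmul_padd_left: "pmul (\<lambda>w. f w + g w) h w = pmul f h w + pmul g h w"
  by (simp add: pmul_def algebra_simps sum.distrib)

lemma pmul_padd_right: "pmul h (\<lambda>w. f w + g w) w = pmul h f w + pmul h g w"
  by (simp add: pmul_def algebra_simps sum.distrib)

lemma pmul_psmul_left: "pmul (\<lambda>w. c * f w) h w = c * pmul f h w"
  by (simp add: pmul_def algebra_simps sum_distrib_left)

lemma pmul_assoc: "pmul (pmul f g) h w = pmul f (pmul g h) w"
proof (induction w arbitrary: f)
  case Nil
  then show ?case by (simp add: pmul_Nil algebra_simps)
next
  case (Cons x w)
  then show ?case
    by (simp add: pmul_Cons pmul_Nil pmul_padd_left pmul_psmul_left algebra_simps)
qed

lemma pmul_nonzeroE:
  assumes "pmul f g w \<noteq> 0"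
  obtains u v where "w = u @ v" "f u \<noteq> 0" "g v \<noteq> 0"
proof -
  from assms obtain i where "f (take i w) * g (drop i w) \<noteq> 0"
    unfolding pmul_def by (meson sum.not_neutral_contains_not_neutral)
  then have "f (take i w) \<noteq> 0" "g (drop i w) \<noteq> 0" by auto
  with that[of "take i w" "drop i w"] show ?thesis by simp
qed

lemma pmul_pone_left: "pmul pone f w = f w"
proof (cases w)
  case Nil
  then show ?thesis by (simp add: pmul_Nil pone_def)
next
  case (Cons x v)
  then show ?thesis by (simp add: pmul_Cons pone_def) (simp add: pmul_def)
qed

lemma pmul_pone_right: "pmul f pone w = f w"
proof (induction w arbitrary: f)
  case (Cons x w)
  have "pone (x # w) = (0::'a)" by (simp add: pone_def)
  with Cons show ?case by (simp add: pmul_Cons)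
qed (simp add: pmul_Nil pone_def)

text \<open>As a type the free algebra becomes an instance of \<open>ring_1\<close>, so ring
  simplification applies; \<open>coeff\<close> leads back to the given encoding.\<close>

typedef (overloaded) 'k fa = "polys :: (nat list \<Rightarrow> 'k::zero) set"
  morphisms coeff Abs_fa
  by (auto simp: polys_def intro!: exI[of _ "\<lambda>_. 0"])

setup_lifting type_definition_fa

lemma finite_supp [simp]: "finite {w. coeff f w \<noteq> 0}"
  using coeff[of f] by (simp add: polys_def)

instantiation fa :: (comm_ring_1) ring_1
begin

lift_definition zero_fa :: "'a fa" is pzero
  by (simp add: polys_def pzero_def)

lift_definition one_fa :: "'a fa" is pone
  by (simp add: polys_def pone_def)

lift_definition plus_fa :: "'a fa \<Rightarrow> 'a fa \<Rightarrow> 'a fa" is padd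
proof -
  fix f g :: "nat list \<Rightarrow> 'a"
  assume "f \<in> polys" "g \<in> polys"
  then show "padd f g \<in> polys"
    by (auto simp: polys_def padd_def
        intro: finite_subset[where B = "{w. f w \<noteq> 0} \<union> {w. g w \<noteq> 0}"])
qed

lift_definition minus_fa :: "'a fa \<Rightarrow> 'a fa \<Rightarrow> 'a fa" is psub
proof -
  fix f g :: "nat list \<Rightarrow> 'a"
  assume "f \<in> polys" "g \<in> polys"
  then show "psub f g \<in> polys"
    by (auto simp: polys_def psub_def
        intro: finite_subset[where B = "{w. f w \<noteq> 0} \<union> {w. g w \<noteq> 0}"])
qed

lift_definition uminus_fa :: "'a fa \<Rightarrow> 'a fa" is "\<lambda>f w. - f w"
  by (simp add: polys_def)

lift_definition times_fa :: "'a fa \<Rightarrow> 'a fa \<Rightarrow> 'a fa" is pmul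
proof -
  fix f g :: "nat list \<Rightarrow> 'a"
  assume "f \<in> polys" "g \<in> polys"
  then have "finite ((\<lambda>(u, v). u @ v) ` ({w. f w \<noteq> 0} \<times> {w. g w \<noteq> 0}))"
    by (auto simp: polys_def)
  moreover have "{w. pmul f g w \<noteq> 0} \<subseteq> (\<lambda>(u, v). u @ v) ` ({w. f w \<noteq> 0} \<times> {w. g w \<noteq> 0})"
    by (force elim: pmul_nonzeroE)
  ultimately show "pmul f g \<in> polys"
    unfolding polys_def by (auto intro: finite_subset)
qed

instance
proof
  fix a b c :: "'a fa"
  show "a * b * c = a * (b * c)"
    by transfer (rule ext, rule pmul_assoc)
  show "1 * a = a"
    by transfer (rule ext, rule pmul_pone_left)
  show "a * 1 = a"
    by transfer (rule ext, rule pmul_pone_right)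
  show "(a + b) * c = a * c + b * c"
    by transfer (simp add: fun_eq_iff padd_def pmul_padd_left)
  show "a * (b + c) = a * b + a * c"
    by transfer (simp add: fun_eq_iff padd_def pmul_padd_right)
  show "(0::'a fa) \<noteq> 1"
    by transfer (simp add: fun_eq_iff pzero_def pone_def)
qed (transfer; simp add: fun_eq_iff padd_def psub_def pzero_def algebra_simps)+

end

lift_definition Mono :: "'k::zero \<Rightarrow> nat list \<Rightarrow> 'k fa" is "\<lambda>c u w. if w = u then c else 0"
  by (simp add: polys_def)

lift_definition Var :: "nat \<Rightarrow> 'k::comm_ring_1 fa" is pvar
  by (simp add: polys_def pvar_def)

abbreviation Const :: "'k::comm_ring_1 \<Rightarrow> 'k fa" where
  "Const c \<equiv> Mono c []"

lemma coeff_simps [simp]: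
  "coeff 0 w = 0" "coeff (f + g) w = coeff f w + coeff g w"
  "coeff (f - g) w = coeff f w - coeff g w" "coeff (- f) w = - coeff f w"
  "coeff (Mono c u) w = (if w = u then c else 0)"
  by (transfer; simp add: padd_def psub_def pzero_def)+

lemma fa_eqI: "(\<And>w. coeff f w = coeff g w) \<Longrightarrow> f = g"
  by (simp add: coeff_inject[symmetric] fun_eq_iff)

lemma coeff_sum [simp]: "coeff (sum h A) w = (\<Sum>x\<in>A. coeff (h x) w)"
  by (induction A rule: infinite_finite_induct) auto

lemma fa_expand: "(f::'k::comm_ring_1 fa) = (\<Sum>w | coeff f w \<noteq> 0. Mono (coeff f w) w)"
  by (rule fa_eqI) (simp add: sum.delta)

lemma fa_induct [case_names zero mono add]:
  fixes f :: "'k::comm_ring_1 fa"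
  assumes "P 0" and m: "\<And>c w. P (Mono c w)" and a: "\<And>f g. P f \<Longrightarrow> P g \<Longrightarrow> P (f + g)"
  shows "P f"
proof -
  have "P (\<Sum>w\<in>A. Mono (h w) w)" if "finite A" for A h
    using that by induction (auto intro: assms)
  then show ?thesis
    by (subst fa_expand) simp
qed

lemma pmul_mono:
  "pmul (\<lambda>w. if w = u then c else 0) (\<lambda>w. if w = v then d else 0) =
   (\<lambda>w. if w = u @ v then c * d else (0::'k::comm_ring_1))"
proof
  fix w
  show "pmul (\<lambda>w. if w = u then c else 0) (\<lambda>w. if w = v then d else 0) w =
    (if w = u @ v then c * d else (0::'k))"
  proof (induction u arbitrary: w)
    case Nil
    then show ?case
      by (cases w) (auto simp: pmul_Nil pmul_Cons, simp_all add: pmul_def)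
  next
    case (Cons x u)
    show ?case
    proof (cases w)
      case (Cons y w')
      then show ?thesis using Cons.IH[of w']
        by (cases "y = x") (simp_all add: pmul_Cons, simp add: pmul_def)
    qed (simp add: pmul_Nil)
  qed
qed

lemma mono_mult [simp]: "Mono c u * Mono d v = Mono (c * d) (u @ v :: nat list)"
  for c d :: "'k::comm_ring_1"
  by transfer (rule pmul_mono)

lemma mono_0 [simp]: "Mono 0 w = (0::'k::comm_ring_1 fa)"
  by (rule fa_eqI) simp

lemma mono_add: "Mono (c + d) w = Mono c w + Mono (d::'k::comm_ring_1) w"
  by (rule fa_eqI) simp

lemma Const_1 [simp]: "Const 1 = (1::'k::comm_ring_1 fa)"
  by transfer (simp add: pone_def fun_eq_iff)

lemma mono_Cons: "Mono c (i # w) = Var i * Mono (c::'k::comm_ring_1) w"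
proof -
  have "Var i = Mono (1::'k) [i]"
    by transfer (simp add: pvar_def)
  then show ?thesis by simp
qed

lemma mono_eq: "Mono c w = Const c * prod_list (map Var w)"
proof -
  have "Mono 1 w = prod_list (map Var w)"
    by (induction w) (simp_all add: mono_Cons)
  then show ?thesis by (metis mono_mult append_Nil mult.right_neutral)
qed

lemma Const_central: "Const c * f = f * Const c"
  by (induction f rule: fa_induct) (simp_all add: algebra_simps)

section \<open>Evaluation of polynomials\<close>

text \<open>A ring homomorphism from the scalars into the centre of \<open>'r\<close> amounts to a
  unitary algebra structure on \<open>'r\<close>. In this form the free algebra, the scalars, the
  Grassmann algebra and the triangular matrices share one evaluation map \<open>ev\<close>.\<close>

locale central_hom =
  fixes \<kappa> :: "'k::comm_ring_1 \<Rightarrow> 'r::ring_1"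
  assumes hom_1: "\<kappa> 1 = 1"
    and hom_add: "\<kappa> (c + d) = \<kappa> c + \<kappa> d"
    and hom_mult: "\<kappa> (c * d) = \<kappa> c * \<kappa> d"
    and central: "\<kappa> c * x = x * \<kappa> c"
begin

lemma hom_0: "\<kappa> 0 = 0"
  using hom_add[of 0 0] by simp

definition ev :: "(nat \<Rightarrow> 'r) \<Rightarrow> 'k fa \<Rightarrow> 'r" where
  "ev \<phi> f = (\<Sum>w | coeff f w \<noteq> 0. \<kappa> (coeff f w) * prod_list (map \<phi> w))"

lemma ev_superset:
  assumes "finite A" "{w. coeff f w \<noteq> 0} \<subseteq> A"
  shows "ev \<phi> f = (\<Sum>w\<in>A. \<kappa> (coeff f w) * prod_list (map \<phi> w))"
  unfolding ev_def by (rule sum.mono_neutral_left) (use assms in \<open>auto simp: hom_0\<close>)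

lemma ev_0 [simp]: "ev \<phi> 0 = 0"
  by (simp add: ev_def)

lemma ev_mono: "ev \<phi> (Mono c w) = \<kappa> c * prod_list (map \<phi> w)"
  by (subst ev_superset[of "{w}"]) (auto simp: hom_0)

lemma ev_Const [simp]: "ev \<phi> (Const c) = \<kappa> c"
  by (simp add: ev_mono)

lemma ev_1 [simp]: "ev \<phi> 1 = 1"
  using ev_Const[of \<phi> 1] by (simp add: hom_1)

lemma ev_add [simp]: "ev \<phi> (f + g) = ev \<phi> f + ev \<phi> g"
proof -
  let ?A = "{w. coeff f w \<noteq> 0} \<union> {w. coeff g w \<noteq> 0}"
  have "finite ?A" by simp
  then show ?thesis
    by (subst (1 2 3) ev_superset[of ?A]) (auto simp: hom_add algebra_simps sum.distrib)
qed

lemma ev_sum [simp]: "ev \<phi> (sum h A) = (\<Sum>x\<in>A. ev \<phi> (h x))"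
  by (induction A rule: infinite_finite_induct) auto

lemma ev_mult [simp]: "ev \<phi> (f * g) = ev \<phi> f * ev \<phi> g"
proof (induction f rule: fa_induct)
  case (mono c u)
  show ?case
  proof (induction g rule: fa_induct)
    case (mono d v)
    have "prod_list (map \<phi> u) * (\<kappa> d * x) = \<kappa> d * (prod_list (map \<phi> u) * x)" for x
      by (metis central mult.assoc)
    then show ?case by (simp add: ev_mono hom_mult mult.assoc)
  qed (simp_all add: algebra_simps)
qed (simp_all add: algebra_simps)

lemma ev_uminus [simp]: "ev \<phi> (- f) = - ev \<phi> f"
  by (metis ev_0 ev_add eq_neg_iff_add_eq_0 add.left_inverse)

lemma ev_diff [simp]: "ev \<phi> (f - g) = ev \<phi> f - ev \<phi> g"
  using ev_add[of \<phi> f "- g"] by simp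

lemma ev_Var [simp]: "ev \<phi> (Var i) = \<phi> i"
  using ev_mono[of \<phi> 1 "[i]"] mono_Cons[of "1::'k" i "[]"] by (simp add: hom_1)

lemma ev_prod_list [simp]: "ev \<phi> (prod_list l) = prod_list (map (ev \<phi>) l)"
  by (induction l) simp_all

end

interpretation FA: central_hom "Const :: 'k::comm_ring_1 \<Rightarrow> 'k fa"
  by unfold_locales (simp_all add: mono_add Const_central)

interpretation SC: central_hom "\<lambda>c::'k::comm_ring_1. c"
  by unfold_locales (simp_all add: mult.commute)

lemma (in central_hom) ev_ev: "ev \<psi> (FA.ev \<phi> f) = ev (\<lambda>i. ev \<psi> (\<phi> i)) f"
  by (induction f rule: fa_induct) (simp_all add: FA.ev_mono ev_mono comp_def)

text \<open>Bridge from the record-based evaluation to \<open>ev\<close>. Compatibility of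
  \<open>rep\<close> is demanded only on a closed set \<open>S\<close>, since the carrier of
  \<open>A_alg\<close> corresponds to a proper subset of the matrix type; \<open>rep\<close> may
  fail to be injective, as for residue classes in \<open>relfree\<close>.\<close>

lemma (in central_hom) alg_eval_transfer:
  fixes R :: "('a, 'k) alg" and rep :: "'r \<Rightarrow> 'a"
  assumes "1 \<in> S" "\<And>x y. x \<in> S \<Longrightarrow> y \<in> S \<Longrightarrow> x + y \<in> S"
    and "\<And>x y. x \<in> S \<Longrightarrow> y \<in> S \<Longrightarrow> x * y \<in> S" "\<And>c. \<kappa> c \<in> S"
    and "\<And>x y. x \<in> S \<Longrightarrow> y \<in> S \<Longrightarrow> aadd R (rep x) (rep y) = rep (x + y)"
    and "\<And>x y. x \<in> S \<Longrightarrow> y \<in> S \<Longrightarrow> amul R (rep x) (rep y) = rep (x * y)"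
    and "\<And>c x. x \<in> S \<Longrightarrow> asmul R c (rep x) = rep (\<kappa> c * x)"
    and "azero R = rep 0" "aone R = rep 1"
    and \<phi>: "\<And>i. \<phi> i \<in> S"
  shows "alg_eval R (coeff f) (\<lambda>i. rep (\<phi> i)) = rep (ev \<phi> f)"
proof -
  have S0: "0 \<in> S" using assms(4)[of 0] by (simp add: hom_0)
  have m: "prod_list (map \<phi> w) \<in> S \<and> mono_eval R (\<lambda>i. rep (\<phi> i)) w = rep (prod_list (map \<phi> w))" for w
  proof (induction w)
    case Nil
    show ?case using assms(1,9) by (simp add: mono_eval_def)
  next
    case (Cons i w)
    then show ?case using assms(3,6)[of "\<phi> i" "prod_list (map \<phi> w)"] \<phi>
      by (simp add: mono_eval_def)
  qed
  have s: "sum_list (map (\<lambda>w. \<kappa> (coeff f w) * prod_list (map \<phi> w)) l) \<in> S \<and>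
    foldr (\<lambda>w acc. aadd R (asmul R (coeff f w) (mono_eval R (\<lambda>i. rep (\<phi> i)) w)) acc) l (azero R)
      = rep (sum_list (map (\<lambda>w. \<kappa> (coeff f w) * prod_list (map \<phi> w)) l))" for l
  proof (induction l)
    case Nil
    show ?case using S0 assms(8) by simp
  next
    case (Cons w l)
    have "\<kappa> (coeff f w) * prod_list (map \<phi> w) \<in> S" using m assms(3,4) by simp
    then show ?case using Cons assms(2,5) assms(7)[of "prod_list (map \<phi> w)"] m[of w] by simp
  qed
  show ?thesis
    unfolding alg_eval_def s[THEN conjunct2] ev_def
    by (simp add: sum_list_distinct_conv_sum_set)
qed

lemma coeff_Const_mult: "coeff (Const c * f) w = c * coeff (f::'k::comm_ring_1 fa) w"
  by (induction f rule: fa_induct) (simp_all add: algebra_simps)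

lemma subst_eq: "subst (coeff f) (\<lambda>i. coeff (\<phi> i)) = coeff (FA.ev \<phi> f)"
  unfolding subst_def
proof (rule FA.alg_eval_transfer[of UNIV])
  show "asmul free_alg c (coeff x) = coeff (Const c * x)" for c and x :: "'a fa"
    by (simp add: free_alg_def psmul_def coeff_Const_mult fun_eq_iff)
qed (simp_all add: free_alg_def plus_fa.rep_eq times_fa.rep_eq zero_fa.rep_eq one_fa.rep_eq)

section \<open>The Grassmann algebra as a ring type\<close>

lemma gsign_empty [simp]: "gsign {} V = 1" "gsign U {} = 1"
  by (simp_all add: gsign_def)

lemma finite_inversions:
  "finite U \<Longrightarrow> finite V \<Longrightarrow> finite {(u, v). u \<in> U \<and> v \<in> V \<and> P u v}"
  by (rule finite_subset[of _ "U \<times> V"]) auto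

lemma gsign_Un_left:
  assumes "finite U" "finite U'" "finite V" "U \<inter> U' = {}"
  shows "gsign (U \<union> U') V = gsign U V * gsign U' V"
proof -
  have "{(u, v). u \<in> U \<union> U' \<and> v \<in> V \<and> v < u} =
    {(u, v). u \<in> U \<and> v \<in> V \<and> v < u} \<union> {(u, v). u \<in> U' \<and> v \<in> V \<and> v < u}"
    by auto
  moreover have "card ({(u, v). u \<in> U \<and> v \<in> V \<and> v < u} \<union> {(u, v). u \<in> U' \<and> v \<in> V \<and> v < u})
    = card {(u, v). u \<in> U \<and> v \<in> V \<and> v < u} + card {(u, v). u \<in> U' \<and> v \<in> V \<and> v < u}"
    using assms by (intro card_Un_disjoint) (auto intro!: finite_inversions)
  ultimately show ?thesis
    by (simp add: gsign_def power_add)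
qed

lemma gsign_Un_right:
  assumes "finite U" "finite V" "finite V'" "V \<inter> V' = {}"
  shows "gsign U (V \<union> V') = gsign U V * gsign U V'"
proof -
  have "{(u, v). u \<in> U \<and> v \<in> V \<union> V' \<and> v < u} =
    {(u, v). u \<in> U \<and> v \<in> V \<and> v < u} \<union> {(u, v). u \<in> U \<and> v \<in> V' \<and> v < u}"
    by auto
  moreover have "card ({(u, v). u \<in> U \<and> v \<in> V \<and> v < u} \<union> {(u, v). u \<in> U \<and> v \<in> V' \<and> v < u})
    = card {(u, v). u \<in> U \<and> v \<in> V \<and> v < u} + card {(u, v). u \<in> U \<and> v \<in> V' \<and> v < u}"
    using assms by (intro card_Un_disjoint) (auto intro!: finite_inversions)
  ultimately show ?thesis
    by (simp add: gsign_def power_add)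
qed

text \<open>Each pair in \<open>U \<times> V\<close> is an inversion for exactly one of the two
  orders, so the two inversion counts add up to \<open>card U * card V\<close>.\<close>

lemma gsign_swap:
  assumes "finite U" "finite V" "U \<inter> V = {}"
  shows "gsign V U = (-1) ^ (card U * card V) * gsign U V"
proof -
  let ?A = "{(u, v). u \<in> U \<and> v \<in> V \<and> v < u}" and ?B = "{(v, u). v \<in> V \<and> u \<in> U \<and> u < v}"
  have "card ?B = card (prod.swap ` ?B)"
    by (simp add: card_image)
  also have "prod.swap ` ?B = {(u, v). u \<in> U \<and> v \<in> V \<and> u < v}"
    by (auto simp: image_iff)
  finally have B: "card ?B = card {(u, v). u \<in> U \<and> v \<in> V \<and> u < v}" .
  have "?A \<union> {(u, v). u \<in> U \<and> v \<in> V \<and> u < v} = U \<times> V"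
    using assms by (auto simp: neq_iff)
  moreover have "card (?A \<union> {(u, v). u \<in> U \<and> v \<in> V \<and> u < v}) =
      card ?A + card {(u, v). u \<in> U \<and> v \<in> V \<and> u < v}"
    using assms by (intro card_Un_disjoint) (auto intro!: finite_inversions)
  ultimately have "card U * card V = card ?A + card ?B"
    by (simp add: B card_cartesian_product)
  then show ?thesis
    by (simp add: gsign_def power_add mult.commute mult.left_commute flip: power_mult_distrib)
qed

text \<open>Cocycle condition behind associativity of the Grassmann product: by multiplicativity
  both sides are \<open>gsign U V * gsign U W * gsign V W\<close>.\<close>

lemma gsign_assoc:
  assumes "finite U" "finite V" "finite W" "U \<inter> V = {}" "U \<inter> W = {}" "V \<inter> W = {}"
  shows "gsign (U \<union> V) W * gsign U V = gsign U (V \<union> W) * gsign V W"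
  using assms by (simp add: gsign_Un_left gsign_Un_right)

lemma gsign_square [simp]: "gsign U V * gsign U V = 1" "gsign U V * (gsign U V * x) = x"
  by (simp_all add: gsign_def flip: power_mult_distrib mult.assoc)

text \<open>Once \<open>U\<close> is chosen, the second index set must be \<open>S - U\<close>.
  Summing over \<open>Pow S\<close> makes the range independent of the supports.\<close>

lemma gmul_eq:
  assumes "a \<in> grass" "b \<in> grass" "finite S"
  shows "gmul a b S = (\<Sum>U\<in>Pow S. gsign U (S - U) * a U * b (S - U))"
proof -
  have fa: "finite {U. a U \<noteq> 0}" and fb: "finite {U. b U \<noteq> 0}"
    using assms by (auto simp: grass_def)
  have "(\<Sum>V | b V \<noteq> 0. if U \<inter> V = {} \<and> U \<union> V = S then gsign U V * a U * b V else 0)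
    = (if U \<subseteq> S then gsign U (S - U) * a U * b (S - U) else 0)" for U
  proof -
    have "(\<Sum>V | b V \<noteq> 0. if U \<inter> V = {} \<and> U \<union> V = S then gsign U V * a U * b V else 0)
      = (\<Sum>V | b V \<noteq> 0. if V = S - U then (if U \<subseteq> S then gsign U V * a U * b V else 0) else 0)"
      by (intro sum.cong) auto
    then show ?thesis using fb by (auto simp: sum.delta)
  qed
  then have "gmul a b S = (\<Sum>U | a U \<noteq> 0. if U \<subseteq> S then gsign U (S - U) * a U * b (S - U) else 0)"
    by (simp add: gmul_def)
  also have "\<dots> = (\<Sum>U\<in>{U. a U \<noteq> 0} \<inter> Pow S. gsign U (S - U) * a U * b (S - U))"
    using fa by (simp add: sum.inter_restrict Pow_def)
  also have "\<dots> = (\<Sum>U\<in>Pow S. gsign U (S - U) * a U * b (S - U))"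
    using assms(3) by (intro sum.mono_neutral_left) auto
  finally show ?thesis .
qed

lemma gmul_nonzeroE:
  assumes "gmul a b S \<noteq> 0"
  obtains U V where "S = U \<union> V" "U \<inter> V = {}" "a U \<noteq> 0" "b V \<noteq> 0"
proof -
  obtain U where U: "a U \<noteq> 0" "(\<Sum>V | b V \<noteq> 0. if U \<inter> V = {} \<and> U \<union> V = S then gsign U V * a U * b V else 0) \<noteq> 0"
    using assms unfolding gmul_def by (auto elim: sum.not_neutral_contains_not_neutral)
  then obtain V where "b V \<noteq> 0" "(if U \<inter> V = {} \<and> U \<union> V = S then gsign U V * a U * b V else 0) \<noteq> 0"
    by (auto elim: sum.not_neutral_contains_not_neutral)
  with U that[of U V] show ?thesis by (auto split: if_splits)
qed

typedef (overloaded) 'k gr = "grass :: (nat set \<Rightarrow> 'k::zero) set"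
  morphisms gcoeff Abs_gr
  by (auto simp: grass_def intro!: exI[of _ "\<lambda>_. 0"])

setup_lifting type_definition_gr

lemma gcoeff_infinite: "infinite S \<Longrightarrow> gcoeff x S = 0"
  using gcoeff[of x] by (auto simp: grass_def)

lemma gr_eqI: "(\<And>S. finite S \<Longrightarrow> gcoeff x S = gcoeff y S) \<Longrightarrow> x = y"
  by (metis gcoeff_infinite gcoeff_inject ext)

text \<open>Both sides sum over the ordered partitions of \<open>S\<close> into three possibly empty
  blocks.\<close>

lemma grass_triangle:
  "finite S \<Longrightarrow> (\<Sum>U\<in>Pow S. \<Sum>V\<in>Pow U. h V (U - V) (S - U)) =
    (\<Sum>V\<in>Pow S. \<Sum>W\<in>Pow (S - V). h V W (S - V - W))"
  for h :: "nat set \<Rightarrow> nat set \<Rightarrow> nat set \<Rightarrow> 'k::comm_monoid_add"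
proof -
  assume "finite S"
  then have "(\<Sum>U\<in>Pow S. \<Sum>V\<in>Pow U. h V (U - V) (S - U)) =
    (\<Sum>(U, V)\<in>Sigma (Pow S) Pow. h V (U - V) (S - U))"
    by (subst sum.Sigma) (auto intro: finite_subset)
  also have "\<dots> = (\<Sum>(V, W)\<in>(SIGMA V:Pow S. Pow (S - V)). h V W (S - V - W))"
    by (rule sum.reindex_bij_witness[where i = "\<lambda>(V, W). (V \<union> W, V)" and j = "\<lambda>(U, V). (V, U - V)"])
       (auto intro!: arg_cong3[where f = h] arg_cong2[where f = "h _"])
  also have "\<dots> = (\<Sum>V\<in>Pow S. \<Sum>W\<in>Pow (S - V). h V W (S - V - W))"
    using \<open>finite S\<close> by (subst sum.Sigma) auto
  finally show ?thesis .
qed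

instantiation gr :: (comm_ring_1) ring_1
begin

lift_definition zero_gr :: "'a gr" is gzero
  by (simp add: grass_def gzero_def)

lift_definition one_gr :: "'a gr" is gone
  by (simp add: grass_def gone_def)

lift_definition plus_gr :: "'a gr \<Rightarrow> 'a gr \<Rightarrow> 'a gr" is gadd
proof -
  fix f g :: "nat set \<Rightarrow> 'a"
  assume "f \<in> grass" "g \<in> grass"
  then show "gadd f g \<in> grass"
    by (auto simp: grass_def gadd_def
        intro: finite_subset[where B = "{w. f w \<noteq> 0} \<union> {w. g w \<noteq> 0}"]) (metis add.left_neutral)
qed

lift_definition uminus_gr :: "'a gr \<Rightarrow> 'a gr" is "\<lambda>f w. - f w"
  by (simp add: grass_def)

definition minus_gr :: "'a gr \<Rightarrow> 'a gr \<Rightarrow> 'a gr" where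
  "minus_gr x y = x + - y"

lift_definition times_gr :: "'a gr \<Rightarrow> 'a gr \<Rightarrow> 'a gr" is gmul
proof -
  fix f g :: "nat set \<Rightarrow> 'a"
  assume *: "f \<in> grass" "g \<in> grass"
  then have "finite ((\<lambda>(u, v). u \<union> v) ` ({w. f w \<noteq> 0} \<times> {w. g w \<noteq> 0}))"
    by (auto simp: grass_def)
  moreover have "{w. gmul f g w \<noteq> 0} \<subseteq> (\<lambda>(u, v). u \<union> v) ` ({w. f w \<noteq> 0} \<times> {w. g w \<noteq> 0})"
    by (force elim: gmul_nonzeroE)
  moreover have "finite S" if "gmul f g S \<noteq> 0" for S
    using that * by (auto elim!: gmul_nonzeroE simp: grass_def)
  ultimately show "gmul f g \<in> grass"
    unfolding grass_def by (auto intro: finite_subset)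
qed

lemma gcoeff_mult:
  fixes x y :: "'a gr"
  shows "finite S \<Longrightarrow> gcoeff (x * y) S = (\<Sum>U\<in>Pow S. gsign U (S - U) * gcoeff x U * gcoeff y (S - U))"
  unfolding times_gr.rep_eq by (rule gmul_eq) (auto simp: gcoeff)

lemma gcoeff_add [simp]: "gcoeff (x + y :: 'a gr) S = gcoeff x S + gcoeff y S"
  by (simp add: plus_gr.rep_eq gadd_def)

lemma gcoeff_zero [simp]: "gcoeff (0 :: 'a gr) S = 0"
  by (simp add: zero_gr.rep_eq gzero_def)

lemma gcoeff_uminus [simp]: "gcoeff (- x :: 'a gr) S = - gcoeff x S"
  by (simp add: uminus_gr.rep_eq)

lemma gcoeff_one: "gcoeff (1 :: 'a gr) S = (if S = {} then 1 else 0)"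
  by (simp add: one_gr.rep_eq gone_def)

instance
proof
  fix a b c :: "'a gr"
  show "a * b * c = a * (b * c)"
  proof (rule gr_eqI)
    fix S :: "nat set" assume S: "finite S"
    define h where "h U V W = gsign (U \<union> V) W * gsign U V * gcoeff a U * gcoeff b V * gcoeff c W" for U V W
    have "gcoeff (a * b * c) S = (\<Sum>U\<in>Pow S. \<Sum>V\<in>Pow U. h V (U - V) (S - U))"
      using S by (auto simp: gcoeff_mult finite_subset sum_distrib_left sum_distrib_right h_def Un_absorb1
          algebra_simps intro!: sum.cong)
    also have "\<dots> = (\<Sum>V\<in>Pow S. \<Sum>W\<in>Pow (S - V). h V W (S - V - W))"
      using S by (rule grass_triangle)
    also have "\<dots> = gcoeff (a * (b * c)) S"
    proof -
      have "h V W (S - V - W) =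
        gsign V (S - V) * gcoeff a V * (gsign W (S - V - W) * gcoeff b W * gcoeff c (S - V - W))"
        if "V \<subseteq> S" "W \<subseteq> S - V" for V W
      proof -
        have "W \<union> (S - V - W) = S - V" using that by auto
        moreover have "finite V" "finite W" using that S by (auto intro: finite_subset)
        moreover have "V \<inter> W = {}" "V \<inter> (S - V - W) = {}" "W \<inter> (S - V - W) = {}" using that by auto
        ultimately have "gsign (V \<union> W) (S - V - W) * gsign V W = gsign V (S - V) * (gsign W (S - V - W) :: 'a)"
          using gsign_assoc[of V W "S - V - W"] S by simp
        then show ?thesis by (simp add: h_def algebra_simps)
      qed
      then show ?thesis
        using S by (simp add: gcoeff_mult sum_distrib_left)
    qed
    finally show "gcoeff (a * b * c) S = gcoeff (a * (b * c)) S" .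
  qed
  show "1 * a = a"
  proof (rule gr_eqI)
    fix S :: "nat set" assume "finite S"
    have "gcoeff (1 * a) S = (\<Sum>U\<in>Pow S. if U = {} then gcoeff a S else 0)"
      unfolding gcoeff_mult[OF \<open>finite S\<close>] by (intro sum.cong) (auto simp: gcoeff_one)
    then show "gcoeff (1 * a) S = gcoeff a S" using \<open>finite S\<close> by simp
  qed
  show "a * 1 = a"
  proof (rule gr_eqI)
    fix S :: "nat set" assume "finite S"
    have "gcoeff (a * 1) S = (\<Sum>U\<in>Pow S. if U = S then gcoeff a S else 0)"
      unfolding gcoeff_mult[OF \<open>finite S\<close>] by (intro sum.cong) (auto simp: gcoeff_one)
    then show "gcoeff (a * 1) S = gcoeff a S" using \<open>finite S\<close> by simp
  qed
  show "(a + b) * c = a * c + b * c" "a * (b + c) = a * b + a * c"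
    by (rule gr_eqI; simp add: gcoeff_mult algebra_simps sum.distrib)+
  show "(0::'a gr) \<noteq> 1"
    by (metis gcoeff_one gcoeff_zero zero_neq_one)
qed (rule gr_eqI; simp add: minus_gr_def algebra_simps)+

end

lemma gcoeff_diff [simp]: "gcoeff (x - y :: 'k::comm_ring_1 gr) S = gcoeff x S - gcoeff y S"
  by (simp add: minus_gr_def del: add_uminus_conv_diff)

lemma gcoeff_sum [simp]: "gcoeff (sum h A :: 'k::comm_ring_1 gr) S = (\<Sum>x\<in>A. gcoeff (h x) S)"
  by (induction A rule: infinite_finite_induct) auto

lift_definition gconst :: "'k::comm_ring_1 \<Rightarrow> 'k gr" is "\<lambda>c S. if S = {} then c else 0"
  by (simp add: grass_def)

lift_definition gen :: "nat \<Rightarrow> 'k::comm_ring_1 gr" is "\<lambda>i S. if S = {i} then 1 else 0"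
  by (simp add: grass_def)

lemma gcoeff_gconst_mult [simp]: "gcoeff (gconst c * x) S = c * gcoeff x S"
proof (cases "finite S")
  case True
  have "gcoeff (gconst c * x) S = (\<Sum>U\<in>Pow S. if U = {} then c * gcoeff x S else 0)"
    unfolding gcoeff_mult[OF True] by (intro sum.cong) (auto simp: gconst.rep_eq)
  with True show ?thesis by simp
qed (simp add: gcoeff_infinite)

lemma gcoeff_mult_gconst [simp]: "gcoeff (x * gconst c) S = c * gcoeff x S"
proof (cases "finite S")
  case True
  have "gcoeff (x * gconst c) S = (\<Sum>U\<in>Pow S. if U = S then c * gcoeff x S else 0)"
    unfolding gcoeff_mult[OF True] by (intro sum.cong) (auto simp: gconst.rep_eq)
  with True show ?thesis by simp
qed (simp add: gcoeff_infinite)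

interpretation GR: central_hom "gconst :: 'k::comm_ring_1 \<Rightarrow> 'k gr"
  by unfold_locales
    (rule gr_eqI; simp add: gconst.rep_eq gcoeff_one)+

lemma gcoeff_gen_mult:
  "finite S \<Longrightarrow> gcoeff (gen i * x) S = (if i \<in> S then gsign {i} (S - {i}) * gcoeff x (S - {i}) else 0)"
proof -
  assume S: "finite S"
  have "gcoeff (gen i * x) S =
    (\<Sum>U\<in>Pow S. if U = {i} then gsign {i} (S - {i}) * gcoeff x (S - {i}) else 0)"
    unfolding gcoeff_mult[OF S] by (intro sum.cong) (auto simp: gen.rep_eq)
  with S show ?thesis by simp
qed

text \<open>The coefficient is a product of signs, and a sign squares to 1, so it cannot annihilate
  a non-zero scalar.\<close>

lemma gcoeff_prod_gen_nonzero:
  "distinct l \<Longrightarrow> gcoeff (prod_list (map gen l)) (set l) \<noteq> (0::'k::comm_ring_1)"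
proof (induction l)
  case (Cons i l)
  then have "gcoeff (prod_list (map gen (i # l))) (set (i # l)) =
    gsign {i} (set l) * (gcoeff (prod_list (map gen l)) (set l) :: 'k)"
    by (simp add: gcoeff_gen_mult insert_Diff_if)
  moreover have "gsign {i} (set l) * x = 0 \<longleftrightarrow> x = 0" for x :: 'k
    by (metis gsign_square(2) mult_zero_right)
  ultimately show ?case using Cons by simp
qed (simp add: gcoeff_one)

subsection \<open>Parity\<close>

definition geven :: "'k::comm_ring_1 gr \<Rightarrow> bool" where
  "geven x \<longleftrightarrow> (\<forall>S. gcoeff x S \<noteq> 0 \<longrightarrow> even (card S))"

definition godd :: "'k::comm_ring_1 gr \<Rightarrow> bool" where
  "godd x \<longleftrightarrow> (\<forall>S. gcoeff x S \<noteq> 0 \<longrightarrow> odd (card S))"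

text \<open>Passing to complements indexes \<open>y * x\<close> like \<open>x * y\<close>, so that
  commutation rules can be read off term by term.\<close>

lemma gcoeff_mult_swap:
  fixes x y :: "'k::comm_ring_1 gr"
  assumes "finite S"
  shows "gcoeff (y * x) S =
    (\<Sum>U\<in>Pow S. (-1) ^ (card U * card (S - U)) * (gsign U (S - U) * gcoeff x U * gcoeff y (S - U)))"
proof -
  have "gcoeff (y * x) S = (\<Sum>U\<in>Pow S. gsign (S - U) U * gcoeff y (S - U) * gcoeff x U)"
    unfolding gcoeff_mult[OF assms]
    by (rule sum.reindex_bij_witness[where i = "\<lambda>U. S - U" and j = "\<lambda>U. S - U"])
       (auto simp: double_diff)
  also have "\<dots> = (\<Sum>U\<in>Pow S. (-1) ^ (card U * card (S - U)) * (gsign U (S - U) * gcoeff x U * gcoeff y (S - U)))"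
  proof (rule sum.cong, simp)
    fix U assume "U \<in> Pow S"
    then have "finite U" "finite (S - U)" "U \<inter> (S - U) = {}"
      using assms by (auto intro: finite_subset)
    from gsign_swap[OF this, where ?'a = 'k] show "gsign (S - U) U * gcoeff y (S - U) * gcoeff x U =
      (-1) ^ (card U * card (S - U)) * (gsign U (S - U) * gcoeff x U * gcoeff y (S - U))"
      by (simp add: algebra_simps)
  qed
  finally show ?thesis .
qed

lemma geven_commute:
  assumes "geven x"
  shows "x * y = y * x"
proof (rule gr_eqI)
  fix S :: "nat set" assume S: "finite S"
  show "gcoeff (x * y) S = gcoeff (y * x) S"
    unfolding gcoeff_mult_swap[OF S, of y x] gcoeff_mult[OF S, of x y]
  proof (rule sum.cong, simp)
    fix U
    show "gsign U (S - U) * gcoeff x U * gcoeff y (S - U) =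
      (-1) ^ (card U * card (S - U)) * (gsign U (S - U) * gcoeff x U * gcoeff y (S - U))"
      using assms by (cases "gcoeff x U = 0") (auto simp: geven_def)
  qed
qed

lemma godd_anticommute:
  assumes "godd x" "godd y"
  shows "y * x = - (x * y)"
proof (rule gr_eqI)
  fix S :: "nat set" assume S: "finite S"
  have "gcoeff (y * x) S = (\<Sum>U\<in>Pow S. - (gsign U (S - U) * gcoeff x U * gcoeff y (S - U)))"
    unfolding gcoeff_mult_swap[OF S]
  proof (rule sum.cong, simp)
    fix U
    show "(-1) ^ (card U * card (S - U)) * (gsign U (S - U) * gcoeff x U * gcoeff y (S - U)) =
      - (gsign U (S - U) * gcoeff x U * gcoeff y (S - U))"
      using assms by (cases "gcoeff x U = 0 \<or> gcoeff y (S - U) = 0") (auto simp: godd_def)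
  qed
  then show "gcoeff (y * x) S = gcoeff (- (x * y)) S"
    by (simp add: gcoeff_mult[OF S] sum_negf)
qed

text \<open>An odd element anticommutes with itself, and characteristic 0 permits dividing by
  2.\<close>

lemma godd_square:
  fixes x :: "'k::field_char_0 gr"
  assumes "godd x"
  shows "x * x = 0"
proof (rule gr_eqI)
  fix S :: "nat set"
  have "gcoeff (x * x) S = - gcoeff (x * x) S"
    using godd_anticommute[OF assms assms] by (metis gcoeff_uminus)
  then show "gcoeff (x * x) S = gcoeff 0 S" by simp
qed

lemma gcoeff_mult_nonzeroE:
  assumes "gcoeff (x * y) S \<noteq> 0"
  obtains U V where "card S = card U + card V" "gcoeff x U \<noteq> 0" "gcoeff y V \<noteq> 0"
proof -
  from assms obtain U V where *: "S = U \<union> V" "U \<inter> V = {}" "gcoeff x U \<noteq> 0" "gcoeff y V \<noteq> 0"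
    unfolding times_gr.rep_eq by (elim gmul_nonzeroE)
  then have "finite U" "finite V" using gcoeff_infinite by blast+
  with * that show ?thesis by (simp add: card_Un_disjoint)
qed

lemma geven_simps [simp]: "geven 0" "geven 1" "geven (gconst c)"
  by (auto simp: geven_def gcoeff_one gconst.rep_eq)

lemma godd_simps [simp]: "godd 0" "godd (gen i)"
  by (auto simp: godd_def gen.rep_eq)

lemma geven_add: "geven x \<Longrightarrow> geven y \<Longrightarrow> geven (x + y)"
  by (simp add: geven_def) (metis add.left_neutral)

lemma godd_add: "godd x \<Longrightarrow> godd y \<Longrightarrow> godd (x + y)"
  by (simp add: godd_def) (metis add.left_neutral)

lemma geven_mult: "geven x \<Longrightarrow> geven y \<Longrightarrow> geven (x * y)"
  unfolding geven_def by (metis even_add gcoeff_mult_nonzeroE)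

lemma godd_mult: "godd x \<Longrightarrow> godd y \<Longrightarrow> geven (x * y)"
  unfolding geven_def godd_def by (metis odd_add gcoeff_mult_nonzeroE)

lemma geven_godd_mult: "geven x \<Longrightarrow> godd y \<Longrightarrow> godd (x * y)"
  unfolding geven_def godd_def by (metis odd_add gcoeff_mult_nonzeroE)

lemma parity_split:
  fixes x :: "'k::comm_ring_1 gr"
  obtains y z where "x = y + z" "geven y" "godd z"
proof -
  have *: "(\<lambda>S. if P S then gcoeff x S else 0) \<in> grass" for P
    using gcoeff[of x] by (auto simp: grass_def intro: finite_subset[of _ "{S. gcoeff x S \<noteq> 0}"])
  define y where "y = Abs_gr (\<lambda>S. if even (card S) then gcoeff x S else 0)"
  define z where "z = Abs_gr (\<lambda>S. if odd (card S) then gcoeff x S else 0)"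
  have "gcoeff y S = (if even (card S) then gcoeff x S else 0)"
    "gcoeff z S = (if odd (card S) then gcoeff x S else 0)" for S
    unfolding y_def z_def by (simp_all add: Abs_gr_inverse *)
  then show ?thesis
    by (intro that[of y z] gr_eqI) (auto simp: geven_def godd_def)
qed

lemma godd_comm_prod_list:
  assumes "godd x" "\<And>y. y \<in> set l \<Longrightarrow> godd y"
  shows "x * prod_list l = prod_list l * x \<or> x * prod_list l = - (prod_list l * x)"
  using assms(2)
proof (induction l)
  case (Cons y l)
  have "x * prod_list (y # l) = - (y * (x * prod_list l))"
    using godd_anticommute[of y x] assms(1) Cons.prems by (simp flip: mult.assoc)
  with Cons show ?case by (auto simp: mult.assoc)
qed simp

text \<open>Up to sign, a repeated factor can be moved next to its twin, where the square is
  0.\<close>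

lemma godd_prod_list_repeated:
  fixes l :: "'k::field_char_0 gr list"
  assumes "\<And>y. y \<in> set l \<Longrightarrow> godd y" "\<not> distinct l"
  shows "prod_list l = 0"
proof -
  from not_distinct_decomp[OF assms(2)] obtain xs ys zs y where l: "l = xs @ [y] @ ys @ [y] @ zs"
    by blast
  have "godd y" "\<And>z. z \<in> set ys \<Longrightarrow> godd z"
    using assms(1) l by auto
  then have "y * prod_list ys = prod_list ys * y \<or> y * prod_list ys = - (prod_list ys * y)" "y * y = 0"
    by (simp_all add: godd_comm_prod_list godd_square)
  then have "y * prod_list ys * y = 0"
    by (auto simp: mult.assoc[of "prod_list ys"])
  moreover have "prod_list l = prod_list xs * (y * prod_list ys * y) * prod_list zs"
    by (simp add: l mult.assoc)
  ultimately show ?thesis by simp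
qed

section \<open>Identities of the matrix algebra and of its relatively free algebras\<close>

context
  notes [[typedef_overloaded]]
begin

text \<open>The upper left entry is an arbitrary Grassmann element; its restriction to the even part
  is imposed by \<open>A_ring\<close>.\<close>

datatype 'k tri = Tri (ta: "'k gr") (tb: "'k gr") (td: "'k gr")

end

instantiation tri :: (comm_ring_1) ring_1
begin

definition "0 = Tri 0 0 0"
definition "1 = Tri 1 0 1"
definition "x + y = Tri (ta x + ta y) (tb x + tb y) (td x + td y)"
definition "x - y = Tri (ta x - ta y) (tb x - tb y) (td x - td y)"
definition "- x = Tri (- ta x) (- tb x) (- td x)"
definition "x * y = Tri (ta x * ta y) (ta x * tb y + tb x * td y) (td x * td y)"

instance
  by standard
    (simp_all add: zero_tri_def one_tri_def plus_tri_def minus_tri_def uminus_tri_def times_tri_def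
      algebra_simps)

end

lemma tri_simps [simp]:
  "ta 0 = 0" "tb 0 = 0" "td 0 = 0" "ta 1 = 1" "tb 1 = 0" "td 1 = 1"
  "ta (x + y) = ta x + ta y" "tb (x + y) = tb x + tb y" "td (x + y) = td x + td y"
  "ta (x - y) = ta x - ta y" "tb (x - y) = tb x - tb y" "td (x - y) = td x - td y"
  "ta (- x) = - ta x" "tb (- x) = - tb x" "td (- x) = - td x"
  "ta (x * y) = ta x * ta y" "tb (x * y) = ta x * tb y + tb x * td y" "td (x * y) = td x * td y"
  by (simp_all add: zero_tri_def one_tri_def plus_tri_def minus_tri_def uminus_tri_def times_tri_def)

lemma tri_eq_iff: "x = y \<longleftrightarrow> ta x = ta y \<and> tb x = tb y \<and> td x = td y"
  by (auto intro: tri.expand)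

definition tconst :: "'k::comm_ring_1 \<Rightarrow> 'k tri" where
  "tconst c = Tri (gconst c) 0 (gconst c)"

interpretation TR: central_hom "tconst :: 'k::comm_ring_1 \<Rightarrow> 'k tri"
proof
  show "tconst c * x = x * tconst c" for c :: 'k and x
    using GR.central[of c "ta x"] GR.central[of c "tb x"] GR.central[of c "td x"]
    by (simp add: tconst_def tri_eq_iff)
qed (simp_all add: tconst_def tri_eq_iff GR.hom_1 GR.hom_add GR.hom_mult)

lemma td_prod_list: "td (prod_list l) = prod_list (map td l)"
  by (induction l) simp_all

lemma td_tconst: "td (tconst c) = gconst c"
  by (simp add: tconst_def)

lemma td_ev: "td (TR.ev \<phi> f) = GR.ev (\<lambda>i. td (\<phi> i)) f"
  by (induction f rule: fa_induct)
    (simp_all add: TR.ev_mono GR.ev_mono td_tconst td_prod_list comp_def)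

definition A_ring :: "'k::comm_ring_1 tri set" where
  "A_ring = {t. geven (ta t)}"

lemma A_ring_closed:
  "1 \<in> A_ring" "x \<in> A_ring \<Longrightarrow> y \<in> A_ring \<Longrightarrow> x + y \<in> A_ring"
  "x \<in> A_ring \<Longrightarrow> y \<in> A_ring \<Longrightarrow> x * y \<in> A_ring" "tconst c \<in> A_ring"
  by (simp_all add: A_ring_def geven_add geven_mult tconst_def)

lemma (in central_hom) ev_closed:
  assumes "\<And>x y. x \<in> S \<Longrightarrow> y \<in> S \<Longrightarrow> x + y \<in> S"
    and "\<And>x y. x \<in> S \<Longrightarrow> y \<in> S \<Longrightarrow> x * y \<in> S" "\<And>c. \<kappa> c \<in> S" "\<And>i. \<phi> i \<in> S"
  shows "ev \<phi> f \<in> S"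
proof (induction f rule: fa_induct)
  case zero
  then show ?case using assms(3)[of 0] by (simp add: hom_0)
next
  case (mono c w)
  have "prod_list (map \<phi> w) \<in> S"
    by (induction w) (use assms(3)[of 1] assms(2,4) in \<open>auto simp: hom_1\<close>)
  then show ?case by (simp add: ev_mono assms)
qed (simp add: assms(1))

definition A_identity :: "'k::comm_ring_1 fa \<Rightarrow> bool" where
  "A_identity f \<longleftrightarrow> (\<forall>\<phi>. (\<forall>i. \<phi> i \<in> A_ring) \<longrightarrow> TR.ev \<phi> f = 0)"

lemma Tid_A_alg: "coeff f \<in> Tid A_alg \<longleftrightarrow> A_identity (f :: 'k::comm_ring_1 fa)"
proof -
  define rep :: "'k tri \<Rightarrow> _" where "rep t = (gcoeff (ta t), gcoeff (tb t), gcoeff (td t))" for t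
  have car: "acar A_alg = rep ` A_ring"
  proof -
    have g0: "gcoeff x \<in> grass0 \<longleftrightarrow> geven x" for x :: "'k gr"
      using gcoeff[of x] by (simp add: grass0_def geven_def)
    have ex: "\<exists>x. a = gcoeff x" if "a \<in> grass" for a :: "'k grel"
      using that Abs_gr_inverse by metis
    show ?thesis
    proof (intro equalityI subsetI)
      fix t :: "'k grel \<times> 'k grel \<times> 'k grel" assume "t \<in> acar A_alg"
      then obtain a b d where t: "t = (a, b, d)" "a \<in> grass0" "b \<in> grass" "d \<in> grass"
        by (auto simp: A_alg_def)
      moreover from t have "a \<in> grass" by (simp add: grass0_def)
      ultimately obtain x y z where "a = gcoeff x" "b = gcoeff y" "d = gcoeff z"
        using ex by metis
      with t g0 have "t = rep (Tri x y z)" "Tri x y z \<in> A_ring"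
        by (simp_all add: rep_def A_ring_def)
      then show "t \<in> rep ` A_ring" by blast
    qed (auto simp: A_alg_def A_ring_def rep_def g0 gcoeff)
  qed
  have ev: "alg_eval A_alg (coeff f) (\<lambda>i. rep (\<phi> i)) = rep (TR.ev \<phi> f)" if "\<And>i. \<phi> i \<in> A_ring" for \<phi>
  proof (rule TR.alg_eval_transfer[of A_ring])
    show "asmul A_alg c (rep x) = rep (tconst c * x)" for c and x :: "'k tri"
      by (simp add: A_alg_def rep_def tconst_def gsmul_def fun_eq_iff)
  qed (simp_all add: that A_ring_closed A_alg_def rep_def plus_gr.rep_eq times_gr.rep_eq
      zero_gr.rep_eq one_gr.rep_eq)
  have zero: "azero A_alg = rep 0" and inj: "rep x = rep y \<longleftrightarrow> x = y" for x y
    by (simp_all add: A_alg_def rep_def zero_gr.rep_eq tri_eq_iff gcoeff_inject)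
  show ?thesis
  proof
    assume f: "coeff f \<in> Tid A_alg"
    show "A_identity f"
      unfolding A_identity_def
    proof (intro allI impI)
      fix \<phi> :: "nat \<Rightarrow> 'k tri" assume \<phi>: "\<forall>i. \<phi> i \<in> A_ring"
      then have "alg_eval A_alg (coeff f) (\<lambda>i. rep (\<phi> i)) = azero A_alg"
        using f by (simp add: Tid_def car)
      with ev \<phi> zero inj show "TR.ev \<phi> f = 0" by metis
    qed
  next
    assume f: "A_identity f"
    have "alg_eval A_alg (coeff f) \<psi> = azero A_alg" if "\<forall>i. \<psi> i \<in> acar A_alg" for \<psi>
    proof -
      from that have "\<forall>i. \<exists>t. t \<in> A_ring \<and> \<psi> i = rep t" by (auto simp: car)
      then obtain \<phi> where \<phi>: "\<And>i. \<phi> i \<in> A_ring" "\<And>i. \<psi> i = rep (\<phi> i)" by metis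
      then have "\<psi> = (\<lambda>i. rep (\<phi> i))" by auto
      with ev[OF \<phi>(1)] f \<phi>(1) zero show ?thesis by (simp add: A_identity_def)
    qed
    then show "coeff f \<in> Tid A_alg" by (simp add: Tid_def coeff)
  qed
qed

section \<open>Relatively free algebras of finite rank\<close>

definition vars_below :: "nat \<Rightarrow> 'k::comm_ring_1 fa set" where
  "vars_below n = {f. \<forall>w. coeff f w \<noteq> 0 \<longrightarrow> (\<forall>i\<in>set w. i < n)}"

lemma polys_n_eq: "polys_n n = coeff ` vars_below n"
proof -
  have "\<exists>f. a = coeff f" if "a \<in> polys" for a :: "nat list \<Rightarrow> 'a"
    using that Abs_fa_inverse by metis
  then show ?thesis
    by (fastforce simp: polys_n_def vars_below_def coeff)
qed

lemma vars_below_add: "f \<in> vars_below n \<Longrightarrow> g \<in> vars_below n \<Longrightarrow> f + g \<in> vars_below n"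
  by (simp add: vars_below_def) (metis add.left_neutral)

lemma vars_below_diff: "f \<in> vars_below n \<Longrightarrow> g \<in> vars_below n \<Longrightarrow> f - g \<in> vars_below n"
  by (simp add: vars_below_def) (metis diff_zero diff_self)

lemma vars_below_mult: "f \<in> vars_below n \<Longrightarrow> g \<in> vars_below n \<Longrightarrow> f * g \<in> vars_below n"
  by (auto simp: vars_below_def times_fa.rep_eq elim!: pmul_nonzeroE)

lemma vars_below_simps [simp]:
  "Const c \<in> vars_below n" "0 \<in> vars_below n" "1 \<in> vars_below n" "Var i \<in> vars_below n \<longleftrightarrow> i < n"
  by (auto simp: vars_below_def Var.rep_eq pvar_def split: if_splits simp flip: Const_1)

lemma vars_below_mono: "m \<le> n \<Longrightarrow> vars_below m \<subseteq> vars_below n"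
  by (force simp: vars_below_def)

lemma A_identity_diff_trans:
  "A_identity (f - g) \<Longrightarrow> A_identity (g - h) \<Longrightarrow> A_identity (f - h)"
  by (auto simp: A_identity_def)

text \<open>An identity of the relatively free algebra of rank \<open>n\<close> is a polynomial that vanishes on
  every tuple of elements of an \<open>n\<close>-generated subalgebra of \<open>A\<close>.\<close>

definition rank_identity :: "nat \<Rightarrow> 'k::comm_ring_1 fa \<Rightarrow> bool" where
  "rank_identity n f \<longleftrightarrow> (\<forall>\<phi> Y. (\<forall>i. \<phi> i \<in> vars_below n) \<longrightarrow> (\<forall>i. Y i \<in> A_ring) \<longrightarrow>
     TR.ev (\<lambda>i. TR.ev Y (\<phi> i)) f = 0)"

text \<open>Evaluating \<open>f\<close> at residue classes gives the class of a substitution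
  instance of \<open>f\<close>, and a class is zero exactly when its representative vanishes on
  \<open>A_ring\<close>. The two evaluations compose by \<open>TR.ev_ev\<close>.\<close>

lemma Tid_relfree: "Tid (relfree A_alg n) = coeff ` {f :: 'k::comm_ring_1 fa. rank_identity n f}"
proof -
  let ?P = "vars_below n :: 'k fa set"
  define J where "J = polys_n n \<inter> (Tid A_alg :: (nat list \<Rightarrow> 'k) set)"
  define R where "R = relfree (A_alg :: (_, 'k) alg) n"
  define rep where "rep g = coeff ` {h \<in> ?P. A_identity (h - g)}" for g
  have J: "coeff x \<in> J \<longleftrightarrow> x \<in> ?P \<and> A_identity x" for x
    by (auto simp: J_def Tid_A_alg polys_n_eq coeff_inject)
  have rep_eq: "{h \<in> polys_n n. psub h (coeff g) \<in> J} = rep g" if "g \<in> ?P" for g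
    unfolding rep_def polys_n_eq using J that vars_below_diff
    by (fastforce simp flip: minus_fa.rep_eq)
  \<comment> \<open>Common treatment of the operations on classes: any operation on polynomials that
    respects congruence modulo the identities of \<open>A_alg\<close> descends to
    \<open>rep\<close>.\<close>
  have rep_op: "{h \<in> polys_n n. \<exists>a\<in>rep x. \<exists>b\<in>rep y. psub h (coeff (op (Abs_fa a) (Abs_fa b))) \<in> J} = rep (op x y)"
    if xy: "x \<in> ?P" "y \<in> ?P" and cl: "\<And>x y. x \<in> ?P \<Longrightarrow> y \<in> ?P \<Longrightarrow> op x y \<in> ?P"
      and cong: "\<And>x y x' y'. A_identity (x' - x) \<Longrightarrow> A_identity (y' - y) \<Longrightarrow> A_identity (op x' y' - op x y)"
    for x y op
  proof (intro equalityI subsetI)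
    fix h assume "h \<in> {h \<in> polys_n n. \<exists>a\<in>rep x. \<exists>b\<in>rep y. psub h (coeff (op (Abs_fa a) (Abs_fa b))) \<in> J}"
    then obtain h' a b where *: "h = coeff h'" "h' \<in> ?P" "A_identity (a - x)" "A_identity (b - y)"
      "psub (coeff h') (coeff (op a b)) \<in> J"
      by (auto simp: rep_def polys_n_eq coeff_inverse)
    then have "A_identity (h' - op a b)" using J by (simp flip: minus_fa.rep_eq)
    with * cong show "h \<in> rep (op x y)"
      unfolding rep_def using A_identity_diff_trans by blast
  next
    fix h assume "h \<in> rep (op x y)"
    then obtain h' where *: "h = coeff h'" "h' \<in> ?P" "A_identity (h' - op x y)"
      by (auto simp: rep_def)
    moreover have "coeff x \<in> rep x" "coeff y \<in> rep y"
      using xy by (auto simp: rep_def A_identity_def)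
    moreover have "psub (coeff h') (coeff (op x y)) \<in> J"
      using * J cl xy vars_below_diff by (metis minus_fa.rep_eq)
    ultimately show "h \<in> {h \<in> polys_n n. \<exists>a\<in>rep x. \<exists>b\<in>rep y. psub h (coeff (op (Abs_fa a) (Abs_fa b))) \<in> J}"
      by (auto simp: polys_n_eq) (metis coeff_inverse)
  qed
  have add: "aadd R (rep x) (rep y) = rep (x + y)" if "x \<in> ?P" "y \<in> ?P" for x y
  proof -
    have "aadd R (rep x) (rep y) =
      {h \<in> polys_n n. \<exists>a\<in>rep x. \<exists>b\<in>rep y. psub h (coeff (Abs_fa a + Abs_fa b)) \<in> J}"
      by (auto simp: R_def relfree_def Let_def J_def rep_def plus_fa.rep_eq coeff_inverse)
    also have "\<dots> = rep (x + y)"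
      by (rule rep_op[OF that]) (simp_all add: vars_below_add, simp add: A_identity_def)
    finally show ?thesis .
  qed
  have mul: "amul R (rep x) (rep y) = rep (x * y)" if "x \<in> ?P" "y \<in> ?P" for x y
  proof -
    have "amul R (rep x) (rep y) =
      {h \<in> polys_n n. \<exists>a\<in>rep x. \<exists>b\<in>rep y. psub h (coeff (Abs_fa a * Abs_fa b)) \<in> J}"
      by (auto simp: R_def relfree_def Let_def J_def rep_def times_fa.rep_eq coeff_inverse)
    also have "\<dots> = rep (x * y)"
      by (rule rep_op[OF that]) (simp_all add: vars_below_mult, simp add: A_identity_def)
    finally show ?thesis .
  qed
  have smul: "asmul R c (rep x) = rep (Const c * x)" if "x \<in> ?P" for c x
  proof -
    have "psmul c (coeff a) = coeff (Const c * a)" for a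
      by (simp add: psmul_def coeff_Const_mult fun_eq_iff)
    \<comment> \<open>The dummy representative \<open>b\<close> casts the unary scalar action into
      the binary format of \<open>rep_op\<close>.\<close>
    then have "asmul R c (rep x) =
      {h \<in> polys_n n. \<exists>a\<in>rep x. \<exists>b\<in>rep x. psub h (coeff (Const c * Abs_fa a)) \<in> J}"
      by (auto simp: R_def relfree_def Let_def J_def rep_def coeff_inverse)
    also have "\<dots> = rep (Const c * x)"
      by (rule rep_op[OF that that, where op = "\<lambda>a _. Const c * a"])
        (simp_all add: vars_below_mult, simp add: A_identity_def)
    finally show ?thesis .
  qed
  have zero: "azero R = rep 0" and one: "aone R = rep 1"
    by (simp_all add: R_def relfree_def Let_def zero_fa.rep_eq[symmetric] one_fa.rep_eq[symmetric]
        rep_eq flip: J_def)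
  have car: "acar R = rep ` ?P"
  proof -
    have "acar R = (\<lambda>g. {h \<in> polys_n n. psub h g \<in> J}) ` polys_n n"
      by (simp add: R_def relfree_def Let_def J_def)
    also have "\<dots> = (\<lambda>g. {h \<in> polys_n n. psub h (coeff g) \<in> J}) ` ?P"
      unfolding polys_n_eq by (simp add: image_image)
    also have "\<dots> = rep ` ?P"
      by (rule image_cong[OF refl rep_eq])
    finally show ?thesis .
  qed
  have ev: "alg_eval R (coeff f) (\<lambda>i. rep (\<phi> i)) = rep (FA.ev \<phi> f)" if "\<And>i. \<phi> i \<in> ?P" for f \<phi>
    by (rule FA.alg_eval_transfer[of ?P])
       (simp_all add: that add mul smul zero one vars_below_add vars_below_mult)
  have evP: "FA.ev \<phi> f \<in> ?P" if "\<And>i. \<phi> i \<in> ?P" for f \<phi>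
    by (rule FA.ev_closed) (simp_all add: that vars_below_add vars_below_mult)
  have rep0: "rep x = rep 0 \<longleftrightarrow> A_identity x" if "x \<in> ?P" for x
  proof
    assume "rep x = rep 0"
    moreover have "coeff x \<in> rep x" using that by (auto simp: rep_def A_identity_def)
    ultimately show "A_identity x" by (auto simp: rep_def coeff_inject)
  next
    assume "A_identity x"
    then have "A_identity (h - x) \<longleftrightarrow> A_identity h" for h
      by (auto simp: A_identity_def)
    then show "rep x = rep 0" by (simp add: rep_def)
  qed
  have "coeff f \<in> Tid R \<longleftrightarrow> rank_identity n f" for f
  proof
    assume f: "coeff f \<in> Tid R"
    show "rank_identity n f"
      unfolding rank_identity_def
    proof (intro allI impI)
      fix \<phi> :: "nat \<Rightarrow> 'k fa" and Y :: "nat \<Rightarrow> 'k tri"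
      assume \<phi>: "\<forall>i. \<phi> i \<in> ?P" and Y: "\<forall>i. Y i \<in> A_ring"
      then have "alg_eval R (coeff f) (\<lambda>i. rep (\<phi> i)) = azero R"
        using f by (simp add: Tid_def car)
      then have "A_identity (FA.ev \<phi> f)" using ev rep0 evP \<phi> zero by simp
      then show "TR.ev (\<lambda>i. TR.ev Y (\<phi> i)) f = 0" using Y by (simp add: A_identity_def TR.ev_ev)
    qed
  next
    assume f: "rank_identity n f"
    have "alg_eval R (coeff f) \<psi> = azero R" if "\<forall>i. \<psi> i \<in> acar R" for \<psi>
    proof -
      from that have "\<forall>i. \<exists>t. t \<in> ?P \<and> \<psi> i = rep t" by (auto simp: car)
      then obtain \<phi> where \<phi>: "\<And>i. \<phi> i \<in> ?P" "\<And>i. \<psi> i = rep (\<phi> i)" by metis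
      then have "\<psi> = (\<lambda>i. rep (\<phi> i))" by auto
      moreover have "A_identity (FA.ev \<phi> f)"
        using f \<phi>(1) by (simp add: A_identity_def rank_identity_def TR.ev_ev)
      ultimately show ?thesis using ev[OF \<phi>(1)] rep0 evP \<phi>(1) zero by simp
    qed
    then show "coeff f \<in> Tid R" by (simp add: Tid_def coeff)
  qed
  moreover have "\<exists>f. a = coeff f" if "a \<in> Tid R" for a
    using that Abs_fa_inverse by (metis (no_types, lifting) Tid_def mem_Collect_eq)
  ultimately show ?thesis unfolding R_def by blast
qed

section \<open>The two generators are identities\<close>

definition comm :: "'r::ring \<Rightarrow> 'r \<Rightarrow> 'r" where
  "comm x y = x * y - y * x"

lemma (in central_hom) ev_comm [simp]: "ev \<phi> (comm f g) = comm (ev \<phi> f) (ev \<phi> g)"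
  by (simp add: comm_def)

definition gen1_fa :: "'k::comm_ring_1 fa" where
  "gen1_fa = comm (Var 0) (Var 1) * comm (comm (Var 2) (Var 3)) (Var 4)"

definition gen2_fa :: "nat \<Rightarrow> 'k::comm_ring_1 fa" where
  "gen2_fa n = prod_list (map (\<lambda>j. comm (Var (2 * j)) (Var (2 * j + 1))) [0..<n div 2 + 2])"

lemma coeff_comm: "coeff (comm f g) = pcomm (coeff f) (coeff g)"
  by (simp add: comm_def pcomm_def minus_fa.rep_eq times_fa.rep_eq)

lemma gen1_eq: "gen1 = coeff gen1_fa"
  by (simp add: gen1_def gen1_fa_def times_fa.rep_eq coeff_comm Var.rep_eq)

lemma gen2_eq: "gen2 n = coeff (gen2_fa n)"
proof -
  have "foldr (\<lambda>j acc. pmul (pcomm (pvar (2 * j)) (pvar (2 * j + 1))) acc) l pone =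
    coeff (prod_list (map (\<lambda>j. comm (Var (2 * j)) (Var (2 * j + 1) :: 'a fa)) l))" for l
    by (induction l) (simp_all add: one_fa.rep_eq times_fa.rep_eq coeff_comm Var.rep_eq)
  then show ?thesis by (simp add: gen2_def gen2_fa_def)
qed

text \<open>Even elements are central, so only the odd parts contribute, and these
  anticommute.\<close>

lemma comm_parity:
  assumes "geven u" "godd v" "geven u'" "godd v'"
  shows "comm (u + v) (u' + v') = (v + v) * v'"
  using assms geven_commute[of u "u' + v'"] geven_commute[of u' v] godd_anticommute[of v v']
  by (simp add: comm_def algebra_simps)

lemma geven_comm: "geven (comm x y)"
proof -
  obtain u v where "x = u + v" "geven u" "godd v" by (rule parity_split)
  moreover obtain u' v' where "y = u' + v'" "geven u'" "godd v'" by (rule parity_split)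
  ultimately show ?thesis by (simp add: comm_parity godd_add godd_mult)
qed

lemma comm_comm_gr: "comm (comm x y) (z :: 'k::comm_ring_1 gr) = 0"
  using geven_commute[OF geven_comm] by (simp add: comm_def[of "comm x y"])

lemma ta_comm: "x \<in> A_ring \<Longrightarrow> ta (comm x y) = 0"
  using geven_commute[of "ta x" "ta y"] by (simp add: comm_def A_ring_def)

lemma td_comm: "td (comm x y) = comm (td x) (td y)"
  by (simp add: comm_def)

text \<open>The first commutator has upper left entry 0 because the even part is commutative, and
  the triple commutator has lower right entry 0. The product of two such matrices is 0.\<close>

lemma rank_identity_gen1: "rank_identity n gen1_fa"
  unfolding rank_identity_def
proof (intro allI impI)
  fix \<phi> :: "nat \<Rightarrow> 'a fa" and Y :: "nat \<Rightarrow> 'a tri"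
  assume Y: "\<forall>i. Y i \<in> A_ring"
  have "TR.ev Y (\<phi> i) \<in> A_ring" for i
    by (rule TR.ev_closed) (simp_all add: A_ring_closed Y)
  then show "TR.ev (\<lambda>i. TR.ev Y (\<phi> i)) gen1_fa = 0"
    by (simp add: gen1_fa_def tri_eq_iff ta_comm td_comm comm_comm_gr)
qed

section \<open>Products of commutators in finitely generated subalgebras\<close>

lemma (in central_hom) ev_cong:
  assumes "f \<in> vars_below n" "\<And>i. i < n \<Longrightarrow> \<phi> i = \<psi> i"
  shows "ev \<phi> f = ev \<psi> f"
  unfolding ev_def
proof (rule sum.cong[OF refl])
  fix w assume "w \<in> {w. coeff f w \<noteq> 0}"
  then have "map \<phi> w = map \<psi> w"
    using assms by (auto simp: vars_below_def)
  then show "\<kappa> (coeff f w) * prod_list (map \<phi> w) = \<kappa> (coeff f w) * prod_list (map \<psi> w)" by (simp only:)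
qed

definition odd_span :: "(nat \<Rightarrow> 'k::comm_ring_1 gr) \<Rightarrow> nat \<Rightarrow> 'k gr set" where
  "odd_span \<theta> N = {(\<Sum>i<N. a i * \<theta> i) | a. \<forall>i. geven (a i)}"

lemma odd_span_add: "x \<in> odd_span \<theta> N \<Longrightarrow> y \<in> odd_span \<theta> N \<Longrightarrow> x + y \<in> odd_span \<theta> N"
proof -
  assume "x \<in> odd_span \<theta> N" "y \<in> odd_span \<theta> N"
  then obtain a b where "x = (\<Sum>i<N. a i * \<theta> i)" "y = (\<Sum>i<N. b i * \<theta> i)"
    "\<forall>i. geven (a i)" "\<forall>i. geven (b i)"
    by (auto simp: odd_span_def)
  then show ?thesis
    by (auto simp: odd_span_def sum.distrib distrib_right geven_add intro!: exI[of _ "\<lambda>i. a i + b i"])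
qed

lemma odd_span_mult: "geven u \<Longrightarrow> x \<in> odd_span \<theta> N \<Longrightarrow> u * x \<in> odd_span \<theta> N"
proof -
  assume u: "geven u" and "x \<in> odd_span \<theta> N"
  then obtain a where "x = (\<Sum>i<N. a i * \<theta> i)" "\<forall>i. geven (a i)"
    by (auto simp: odd_span_def)
  then show ?thesis using u
    by (auto simp: odd_span_def sum_distrib_left mult.assoc geven_mult intro!: exI[of _ "\<lambda>i. u * a i"])
qed

lemma odd_span_gen:
  assumes "i < N" shows "\<theta> i \<in> odd_span \<theta> N"
proof -
  have "(\<Sum>j<N. (if j = i then 1 else 0) * \<theta> j) = (\<Sum>j<N. if j = i then \<theta> i else 0)"
    by (rule sum.cong) auto
  also have "\<dots> = \<theta> i" using assms by simp
  finally show ?thesis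
    by (auto simp: odd_span_def intro!: exI[of _ "\<lambda>j. if j = i then 1 else 0"])
qed

lemma odd_span_0: "0 \<in> odd_span \<theta> N"
  by (auto simp: odd_span_def intro!: exI[of _ "\<lambda>_. 0"])

lemma godd_odd_span:
  assumes "\<And>i. godd (\<theta> i)" "x \<in> odd_span \<theta> N"
  shows "godd x"
proof -
  obtain a where a: "x = (\<Sum>i<N. a i * \<theta> i)" "\<forall>i. geven (a i)"
    using assms by (auto simp: odd_span_def)
  have "godd (\<Sum>i\<in>I. a i * \<theta> i)" for I
    by (induction I rule: infinite_finite_induct) (use assms a in \<open>auto intro: godd_add geven_godd_mult\<close>)
  with a show ?thesis by simp
qed

text \<open>Pigeonhole: the factors of \<open>vs\<close> are expanded one at a time, and
  \<open>l\<close> records the generators chosen so far. More than \<open>N\<close> choices among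
  \<open>N\<close> odd generators force a repetition.\<close>

lemma prod_list_odd_span:
  fixes \<theta> :: "nat \<Rightarrow> 'k::field_char_0 gr"
  assumes "\<And>i. godd (\<theta> i)" "set vs \<subseteq> odd_span \<theta> N" "set l \<subseteq> {..<N}" "length l + length vs > N"
  shows "prod_list (map \<theta> l) * prod_list vs = 0"
  using assms(2-)
proof (induction vs arbitrary: l)
  case Nil
  then have "card (set l) < length l"
    using card_mono[of "{..<N}" "set l"] by simp
  then have "\<not> distinct l" using distinct_card[of l] by auto
  then have "prod_list (map \<theta> l) = 0"
    using assms(1) by (intro godd_prod_list_repeated) (auto simp: distinct_map)
  then show ?case by simp
next
  case (Cons v vs)
  obtain a where a: "v = (\<Sum>i<N. a i * \<theta> i)" "\<forall>i. geven (a i)"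
    using Cons.prems by (auto simp: odd_span_def)
  have "prod_list (map \<theta> l) * prod_list (v # vs) = (\<Sum>i<N. prod_list (map \<theta> l) * (a i * \<theta> i) * prod_list vs)"
    by (simp add: a sum_distrib_left sum_distrib_right mult.assoc)
  also have "\<dots> = (\<Sum>i<N. a i * (prod_list (map \<theta> (l @ [i])) * prod_list vs))"
  proof (rule sum.cong[OF refl])
    fix i
    have "prod_list (map \<theta> l) * a i = a i * prod_list (map \<theta> l)"
      using a geven_commute by metis
    then show "prod_list (map \<theta> l) * (a i * \<theta> i) * prod_list vs =
      a i * (prod_list (map \<theta> (l @ [i])) * prod_list vs)"
      by (simp add: mult.assoc[symmetric])
  qed
  also have "\<dots> = 0"
  proof (rule sum.neutral, rule ballI)
    fix i assume "i \<in> {..<N}"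
    then show "a i * (prod_list (map \<theta> (l @ [i])) * prod_list vs) = 0"
      using Cons.IH[of "l @ [i]"] Cons.prems by simp
  qed
  finally show ?case .
qed

text \<open>By \<open>comm_parity\<close> each commutator is a product of two elements of the span
  of the odd parts of \<open>N\<close> generators, so the whole product has more than
  \<open>N\<close> such factors.\<close>

lemma prod_comm_vanishes:
  fixes \<delta> :: "nat \<Rightarrow> 'k::field_char_0 gr"
  assumes "\<And>c. c \<in> set cs \<Longrightarrow>
      \<exists>p q. p \<in> vars_below N \<and> q \<in> vars_below N \<and> c = comm (GR.ev \<delta> p) (GR.ev \<delta> q)"
    and "2 * length cs > N"
  shows "prod_list cs = 0"
proof -
  have "\<forall>i. \<exists>y z. \<delta> i = y + z \<and> geven y \<and> godd z" by (metis parity_split)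
  then obtain y \<theta> where \<delta>: "\<And>i. \<delta> i = y i + \<theta> i" "\<And>i. geven (y i)" "\<And>i. godd (\<theta> i)"
    by metis
  \<comment> \<open>Even elements plus the odd span: a product of two odd elements is even again, so
    this set is closed under multiplication.\<close>
  let ?S = "{u + v | u v. geven u \<and> v \<in> odd_span \<theta> N}"
  have ev: "GR.ev \<delta> p \<in> ?S" if "p \<in> vars_below N" for p
  proof -
    \<comment> \<open>Only \<open>\<delta> i\<close> with \<open>i < N\<close> is covered by the
      span; the other values are reset to 0 so that \<open>GR.ev_closed\<close> applies to every
      variable.\<close>
    have "GR.ev \<delta> p = GR.ev (\<lambda>i. if i < N then \<delta> i else 0) p"
      using that by (rule GR.ev_cong) simp
    also have "\<dots> \<in> ?S"
    proof (rule GR.ev_closed)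
      fix a b assume "a \<in> ?S" "b \<in> ?S"
      then obtain u v u' v' where *: "a = u + v" "b = u' + v'" "geven u" "geven u'"
        "v \<in> odd_span \<theta> N" "v' \<in> odd_span \<theta> N" by blast
      have "a + b = (u + u') + (v + v')" by (simp add: * algebra_simps)
      with * show "a + b \<in> ?S" using geven_add odd_span_add by blast
      have "v * u' = u' * v" using * geven_commute by metis
      then have "a * b = (u * u' + v * v') + (u * v' + u' * v)" by (simp add: * algebra_simps)
      moreover have "godd v" "godd v'" using * \<delta>(3) godd_odd_span by blast+
      moreover from this have "geven (u * u' + v * v')" "u * v' + u' * v \<in> odd_span \<theta> N"
        using * by (simp_all add: geven_add geven_mult godd_mult odd_span_add odd_span_mult)
      ultimately show "a * b \<in> ?S" by blast
    next
      fix c :: 'k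
      have "gconst c = gconst c + 0" by simp
      then show "gconst c \<in> ?S" using odd_span_0 geven_simps(3) by blast
    next
      fix i
      show "(if i < N then \<delta> i else 0) \<in> ?S"
      proof (cases "i < N")
        case True
        with \<delta> odd_span_gen show ?thesis by fastforce
      next
        case False
        have "0 = 0 + (0 :: 'k gr)" by simp
        with False odd_span_0 geven_simps(1) show ?thesis by force
      qed
    qed
    finally show ?thesis .
  qed
  have "\<exists>v v'. v \<in> odd_span \<theta> N \<and> v' \<in> odd_span \<theta> N \<and> c = v * v'" if "c \<in> set cs" for c
  proof -
    from assms(1)[OF that] obtain p q where
      "p \<in> vars_below N" "q \<in> vars_below N" "c = comm (GR.ev \<delta> p) (GR.ev \<delta> q)" by blast
    moreover from this obtain u v where "GR.ev \<delta> p = u + v" "geven u" "v \<in> odd_span \<theta> N"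
      using ev by blast
    moreover from calculation obtain u' v' where "GR.ev \<delta> q = u' + v'" "geven u'" "v' \<in> odd_span \<theta> N"
      using ev by blast
    ultimately have *: "c = comm (u + v) (u' + v')" "geven u" "geven u'"
        "v \<in> odd_span \<theta> N" "v' \<in> odd_span \<theta> N" by simp_all
    moreover have "godd v" "godd v'" using * \<delta>(3) godd_odd_span by blast+
    ultimately have "c = (v + v) * v'" by (simp add: comm_parity)
    with * odd_span_add show ?thesis by blast
  qed
  then have "\<exists>vs. set vs \<subseteq> odd_span \<theta> N \<and> length vs = 2 * length cs \<and> prod_list vs = prod_list cs"
  proof (induction cs)
    case (Cons c cs)
    then obtain vs where vs: "set vs \<subseteq> odd_span \<theta> N" "length vs = 2 * length cs" "prod_list vs = prod_list cs"
      by auto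
    obtain v v' where "v \<in> odd_span \<theta> N" "v' \<in> odd_span \<theta> N" "c = v * v'"
      using Cons.prems by fastforce
    with vs show ?case by (intro exI[of _ "v # v' # vs"]) (simp add: mult.assoc)
  qed simp
  then obtain vs where "set vs \<subseteq> odd_span \<theta> N" "length vs = 2 * length cs" "prod_list vs = prod_list cs"
    by blast
  with prod_list_odd_span[of \<theta> vs N "[]"] \<delta>(3) assms(2) show ?thesis by simp
qed

text \<open>The first commutator has upper left entry 0, so it remains to annihilate the lower right
  entry of the product of the others. For even \<open>n\<close> these are \<open>n div 2 + 1\<close>
  commutators, giving \<open>n + 2\<close> odd factors over \<open>n + 1\<close> generators.\<close>

lemma rank_identity_gen2:
  assumes "even n"
  shows "rank_identity (n + 1) (gen2_fa n :: 'k::field_char_0 fa)"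
  unfolding rank_identity_def
proof (intro allI impI)
  fix \<phi> :: "nat \<Rightarrow> 'k fa" and Y :: "nat \<Rightarrow> 'k tri"
  assume \<phi>: "\<forall>i. \<phi> i \<in> vars_below (n + 1)" and Y: "\<forall>i. Y i \<in> A_ring"
  define Z where "Z i = TR.ev Y (\<phi> i)" for i
  have Z: "Z i \<in> A_ring" for i
    unfolding Z_def by (rule TR.ev_closed) (simp_all add: A_ring_closed Y)
  define cs where "cs = map (\<lambda>j. comm (Z (2 * j)) (Z (2 * j + 1))) [1..<n div 2 + 2]"
  have "td (prod_list cs) = prod_list (map td cs)"
    by (rule td_prod_list)
  also have "\<dots> = 0"
  proof (rule prod_comm_vanishes)
    show "n + 1 < 2 * length (map td cs)"
      using assms by (simp add: cs_def) presburger
    fix c assume "c \<in> set (map td cs)"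
    then obtain j where "c = comm (td (Z (2 * j))) (td (Z (2 * j + 1)))"
      by (auto simp: cs_def td_comm simp del: upt_Suc)
    then show "\<exists>p q. p \<in> vars_below (n + 1) \<and> q \<in> vars_below (n + 1) \<and>
        c = comm (GR.ev (\<lambda>i. td (Y i)) p) (GR.ev (\<lambda>i. td (Y i)) q)"
      using \<phi> by (auto simp: Z_def td_ev)
  qed
  finally have "td (prod_list cs) = 0" .
  moreover have "ta (prod_list cs) = 0"
  proof -
    have "[1..<n div 2 + 2] = 1 # [2..<n div 2 + 2]"
      using upt_conv_Cons[of 1 "n div 2 + 2"] by (simp add: numeral_2_eq_2)
    then have "cs = comm (Z 2) (Z 3) # map (\<lambda>j. comm (Z (2 * j)) (Z (2 * j + 1))) [2..<n div 2 + 2]"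
      unfolding cs_def by (simp only: list.map) simp
    then show ?thesis using ta_comm[OF Z] by (simp only: prod_list.Cons tri_simps mult_zero_left)
  qed
  moreover have "TR.ev Z (gen2_fa n) = comm (Z 0) (Z 1) * prod_list cs"
  proof -
    have "[0..<n div 2 + 2] = 0 # [1..<n div 2 + 2]"
      using upt_conv_Cons[of 0 "n div 2 + 2"] by simp
    then show ?thesis
      unfolding gen2_fa_def cs_def by (simp add: comp_def del: upt_Suc)
  qed
  ultimately show "TR.ev (\<lambda>i. TR.ev Y (\<phi> i)) (gen2_fa n) = 0"
    using ta_comm[OF Z] unfolding Z_def[symmetric] by (simp add: tri_eq_iff)
qed

section \<open>T-ideals\<close>

definition T_ideal :: "'k::comm_ring_1 fa set \<Rightarrow> bool" where
  "T_ideal I \<longleftrightarrow> 0 \<in> I \<and> (\<forall>f\<in>I. \<forall>g\<in>I. f + g \<in> I) \<and> (\<forall>f\<in>I. \<forall>h. h * f \<in> I \<and> f * h \<in> I) \<and>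
     (\<forall>f\<in>I. \<forall>\<phi>. FA.ev \<phi> f \<in> I)"

lemma polys_eq: "polys = range coeff"
  by (rule type_definition.Rep_range[OF type_definition_fa, symmetric])

lemma is_T_ideal_iff:
  fixes I :: "'k::comm_ring_1 fa set"
  shows "is_T_ideal (coeff ` I) \<longleftrightarrow> T_ideal I"
proof -
  have "(\<forall>f\<in>coeff ` I. \<forall>\<phi>. (\<forall>i. \<phi> i \<in> polys) \<longrightarrow> subst f \<phi> \<in> coeff ` I) \<longleftrightarrow>
    (\<forall>f\<in>I. \<forall>\<phi>. FA.ev \<phi> f \<in> I)"
  proof (intro iffI ballI allI impI)
    fix f and \<phi> :: "nat \<Rightarrow> 'k fa"
    assume *: "\<forall>f\<in>coeff ` I. \<forall>\<phi>. (\<forall>i. \<phi> i \<in> polys) \<longrightarrow> subst f \<phi> \<in> coeff ` I" "f \<in> I"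
    moreover have "\<forall>i. coeff (\<phi> i) \<in> polys" by (simp add: coeff)
    ultimately have "subst (coeff f) (\<lambda>i. coeff (\<phi> i)) \<in> coeff ` I" by simp
    then show "FA.ev \<phi> f \<in> I" by (auto simp: subst_eq coeff_inject)
  next
    fix f and \<phi> :: "nat \<Rightarrow> nat list \<Rightarrow> 'k"
    assume *: "\<forall>f\<in>I. \<forall>\<phi>. FA.ev \<phi> f \<in> I" "f \<in> coeff ` I" "\<forall>i. \<phi> i \<in> (polys :: (nat list \<Rightarrow> 'k) set)"
    obtain g where g: "f = coeff g" "g \<in> I" using * by blast
    have "\<phi> = (\<lambda>i. coeff (Abs_fa (\<phi> i)))" using *(3) by (simp add: Abs_fa_inverse)
    then have "subst f \<phi> = coeff (FA.ev (\<lambda>i. Abs_fa (\<phi> i)) g)"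
      using subst_eq g(1) by metis
    with * g show "subst f \<phi> \<in> coeff ` I" by blast
  qed
  moreover have "is_ideal (coeff ` I) \<longleftrightarrow> 0 \<in> I \<and> (\<forall>f\<in>I. \<forall>g\<in>I. f + g \<in> I) \<and> (\<forall>f\<in>I. \<forall>h. h * f \<in> I \<and> f * h \<in> I)"
    unfolding is_ideal_def polys_eq
    by (auto simp: image_iff coeff_inject simp flip: plus_fa.rep_eq times_fa.rep_eq zero_fa.rep_eq)
  ultimately show ?thesis by (auto simp: is_T_ideal_def T_ideal_def)
qed

lemma T_gen_subset:
  assumes "T_ideal I" "S \<subseteq> I"
  shows "T_gen (coeff ` S) \<subseteq> coeff ` I"
  using assms by (simp add: T_gen_def is_T_ideal_iff Inter_lower image_mono)

text \<open>A T-ideal of raw functions is contained in \<open>polys\<close>, the range of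
  \<open>coeff\<close>, hence is the image of its preimage; so testing typed T-ideals
  suffices.\<close>

lemma in_T_genI:
  assumes "\<And>I. T_ideal I \<Longrightarrow> S \<subseteq> I \<Longrightarrow> f \<in> I"
  shows "coeff f \<in> T_gen (coeff ` S)"
  unfolding T_gen_def
proof clarify
  fix I' assume I': "is_T_ideal I'" "coeff ` S \<subseteq> I'"
  then have "I' \<subseteq> range coeff" by (simp add: is_T_ideal_def is_ideal_def polys_eq)
  then have "I' = coeff ` (coeff -` I')" by auto
  with I' is_T_ideal_iff assms[of "coeff -` I'"] show "coeff f \<in> I'" by (metis image_subset_iff_subset_vimage vimageD)
qed

lemma T_ideal_rank_identity: "T_ideal {f. rank_identity n f}"
  unfolding T_ideal_def
proof (intro conjI ballI allI)
  fix f \<phi> assume f: "f \<in> {f. rank_identity n (f :: 'a fa)}"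
  show "FA.ev \<phi> f \<in> {f. rank_identity n f}"
    unfolding rank_identity_def
  proof (intro CollectI allI impI)
    fix \<psi> :: "nat \<Rightarrow> 'a fa" and Y :: "nat \<Rightarrow> 'a tri"
    assume \<psi>: "\<forall>i. \<psi> i \<in> vars_below n" and Y: "\<forall>i. Y i \<in> A_ring"
    have "FA.ev \<psi> (\<phi> i) \<in> vars_below n" for i
      by (rule FA.ev_closed) (simp_all add: \<psi> vars_below_add vars_below_mult)
    then have "TR.ev (\<lambda>i. TR.ev Y (FA.ev \<psi> (\<phi> i))) f = 0"
      using f Y by (simp add: rank_identity_def)
    then show "TR.ev (\<lambda>i. TR.ev Y (\<psi> i)) (FA.ev \<phi> f) = 0"
      by (simp add: TR.ev_ev)
  qed
qed (simp_all add: rank_identity_def)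

lemma rank_identity_mono: "m \<le> n \<Longrightarrow> rank_identity n f \<Longrightarrow> rank_identity m f"
  using vars_below_mono unfolding rank_identity_def by blast

section \<open>Linear independence of monomial functions\<close>

text \<open>Monomials are characters of the multiplicative monoid of tuples of scalars, so this is
  Dedekind's independence argument.\<close>

lemma monomial_functions_independent:
  fixes c :: "nat multiset \<Rightarrow> 'k::field_char_0"
  assumes "finite M" "\<And>a. (\<Sum>\<alpha>\<in>M. c \<alpha> * prod_mset (image_mset a \<alpha>)) = 0" "\<alpha> \<in> M"
  shows "c \<alpha> = 0"
  using assms
proof (induction M arbitrary: c \<alpha> rule: finite_induct)
  case (insert \<alpha> M c \<delta>)
  have M: "c \<beta> = 0" if \<beta>: "\<beta> \<in> M" for \<beta>
  proof -
    from \<beta> insert.hyps have "\<alpha> \<noteq> \<beta>" by blast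
    then obtain i where i: "count \<alpha> i \<noteq> count \<beta> i" by (auto simp: multiset_eq_iff)
    \<comment> \<open>Doubling a coordinate in which \<open>\<alpha>\<close> and
      \<open>\<beta>\<close> have different degrees scales the two monomials differently.
      Subtracting a multiple of the original relation then removes the \<open>\<alpha>\<close> term
      and keeps the \<open>\<beta>\<close> term.\<close>
    define b :: "nat \<Rightarrow> 'k" where "b j = (if j = i then 2 else 1)" for j
    have b: "prod_mset (image_mset b \<gamma>) = 2 ^ count \<gamma> i" for \<gamma>
      by (induction \<gamma>) (auto simp: b_def)
    have "of_nat (2 ^ count \<alpha> i) \<noteq> (of_nat (2 ^ count \<beta> i) :: 'k)"
      unfolding of_nat_eq_iff using i by simp
    then have ne: "(2::'k) ^ count \<alpha> i \<noteq> 2 ^ count \<beta> i" by simp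
    have "(\<Sum>\<gamma>\<in>M. c \<gamma> * (2 ^ count \<gamma> i - 2 ^ count \<alpha> i) * prod_mset (image_mset a \<gamma>)) = 0" for a
    proof -
      have ab: "prod_mset (image_mset (\<lambda>j. a j * b j) \<gamma>) = prod_mset (image_mset a \<gamma>) * 2 ^ count \<gamma> i" for \<gamma>
        by (simp add: prod_mset.distrib b)
      have "(\<Sum>\<gamma>\<in>insert \<alpha> M. c \<gamma> * (2 ^ count \<gamma> i - 2 ^ count \<alpha> i) * prod_mset (image_mset a \<gamma>)) =
        (\<Sum>\<gamma>\<in>insert \<alpha> M. c \<gamma> * prod_mset (image_mset (\<lambda>j. a j * b j) \<gamma>)) -
        2 ^ count \<alpha> i * (\<Sum>\<gamma>\<in>insert \<alpha> M. c \<gamma> * prod_mset (image_mset a \<gamma>))"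
        unfolding sum_distrib_left sum_subtractf[symmetric]
        by (intro sum.cong refl) (simp add: ab algebra_simps)
      also have "\<dots> = 0" by (simp only: insert.prems(1) mult_zero_right diff_zero)
      finally show ?thesis using insert.hyps by simp
    qed
    from insert.IH[OF this \<beta>] ne show ?thesis by simp
  qed
  have "c \<alpha> = 0"
  proof -
    have "(\<Sum>\<gamma>\<in>M. c \<gamma> * prod_mset (image_mset (\<lambda>_. 1) \<gamma>)) = 0"
      using M by (intro sum.neutral) simp
    moreover have "c \<alpha> * prod_mset (image_mset (\<lambda>_. 1) \<alpha>) +
        (\<Sum>\<gamma>\<in>M. c \<gamma> * prod_mset (image_mset (\<lambda>_. 1) \<gamma>)) = 0"
      using insert.prems(1)[of "\<lambda>_. 1"] insert.hyps by simp
    ultimately show ?thesis by simp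
  qed
  with M insert.prems(2) show ?case by blast
qed simp

lemma prod_list_map_mset: "prod_list (map a w) = prod_mset (image_mset a (mset w))"
  for a :: "nat \<Rightarrow> 'k::comm_ring_1"
  by (induction w) simp_all

section \<open>The commutator ideal\<close>

text \<open>Left multiples are enough for a two-sided ideal, as \<open>comm_ideal_rmult\<close>
  shows; inductions then have a single simple generator.\<close>

inductive_set comm_ideal :: "'k::comm_ring_1 fa set" where
  comm: "p * comm q r \<in> comm_ideal"
| add: "f \<in> comm_ideal \<Longrightarrow> g \<in> comm_ideal \<Longrightarrow> f + g \<in> comm_ideal"

lemma comm_ideal_0: "0 \<in> comm_ideal"
  using comm_ideal.comm[of 0] by simp

lemma comm_ideal_lmult: "f \<in> comm_ideal \<Longrightarrow> h * f \<in> comm_ideal"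
  by (induction rule: comm_ideal.induct)
    (simp_all add: distrib_left comm_ideal.add comm_ideal.comm flip: mult.assoc)

text \<open>The Leibniz rule \<open>[q, r h] = [q, r] h + r [q, h]\<close> absorbs the right
  factor.\<close>

lemma comm_ideal_rmult: "f \<in> comm_ideal \<Longrightarrow> f * h \<in> comm_ideal"
proof (induction rule: comm_ideal.induct)
  case (comm p q r)
  have "p * comm q r * h = p * comm q (r * h) + (- (p * r)) * comm q h"
    by (simp add: comm_def algebra_simps)
  then show ?case by (metis comm_ideal.intros)
qed (simp add: distrib_right comm_ideal.add)

lemma comm_ideal_sum: "(\<And>x. x \<in> A \<Longrightarrow> h x \<in> comm_ideal) \<Longrightarrow> sum h A \<in> comm_ideal"
  by (induction A rule: infinite_finite_induct) (auto intro: comm_ideal.add comm_ideal_0)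

abbreviation word :: "nat list \<Rightarrow> 'k::comm_ring_1 fa" where
  "word w \<equiv> prod_list (map Var w)"

definition sorted_word :: "nat multiset \<Rightarrow> 'k::comm_ring_1 fa" where
  "sorted_word \<alpha> = word (sorted_list_of_multiset \<alpha>)"

text \<open>Moving the first letter of \<open>w\<close> to the front of \<open>w'\<close> costs one
  commutator; induction treats the remaining letters.\<close>

lemma word_diff_comm_ideal:
  "mset w = mset w' \<Longrightarrow> word w - word w' \<in> (comm_ideal :: 'k::comm_ring_1 fa set)"
proof (induction w arbitrary: w')
  case Nil
  then show ?case by (simp add: comm_ideal_0)
next
  case (Cons i w)
  then have "i \<in> set w'" by (metis list.set_intros(1) set_mset_mset)
  then obtain x y where w': "w' = x @ i # y" by (meson split_list)
  with Cons have "word w - word (x @ y) \<in> (comm_ideal :: 'k fa set)" by (intro Cons.IH) simp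
  then have "Var i * (word w - word (x @ y)) + 1 * comm (Var i) (word x) * word y \<in> (comm_ideal :: 'k fa set)"
    by (intro comm_ideal.add comm_ideal_lmult[of "_ - _"] comm_ideal_rmult[OF comm_ideal.comm])
  also have "Var i * (word w - word (x @ y)) + 1 * comm (Var i) (word x) * word y = word (i # w) - word w'"
    by (simp add: w' comm_def algebra_simps)
  finally show ?case .
qed

text \<open>The cost of inserting the letter \<open>i\<close>, appended at the end, into a sorted
  word; these are the left factors of the Fox expansion.\<close>

definition step :: "nat multiset \<times> nat \<Rightarrow> 'k::comm_ring_1 fa" where
  "step = (\<lambda>(\<alpha>, i). sorted_word \<alpha> * Var i - sorted_word (add_mset i \<alpha>))"

lemma step_comm_ideal: "step y \<in> comm_ideal"
proof (cases y)
  case (Pair \<alpha> i)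
  have "word (sorted_list_of_multiset \<alpha> @ [i]) - word (sorted_list_of_multiset (add_mset i \<alpha>)) \<in> comm_ideal"
    by (rule word_diff_comm_ideal) simp
  with Pair show ?thesis by (simp add: step_def sorted_word_def)
qed

text \<open>The letters of \<open>w\<close> are absorbed one by one into the sorted prefix; each
  absorption costs one \<open>step\<close> times the letters not yet read.\<close>

lemma word_telescope:
  "(sorted_word \<beta> :: 'k::comm_ring_1 fa) * word w = sorted_word (\<beta> + mset w) +
    (\<Sum>k<length w. step (\<beta> + mset (take k w), w ! k) * word (drop (Suc k) w))"
proof (induction w arbitrary: \<beta>)
  case (Cons i w)
  have "(sorted_word \<beta> :: 'k fa) * word (i # w) = step (\<beta>, i) * word w + sorted_word (add_mset i \<beta>) * word w"
    by (simp add: step_def algebra_simps)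
  also have "\<dots> = step (\<beta>, i) * word w + (sorted_word (\<beta> + mset (i # w)) +
    (\<Sum>k<length w. step (\<beta> + mset (take (Suc k) (i # w)), (i # w) ! Suc k) * word (drop (Suc (Suc k)) (i # w))))"
    using Cons.IH[of "add_mset i \<beta>"] by simp
  finally show ?case by (simp add: sum.lessThan_Suc_shift algebra_simps del: sum.lessThan_Suc)
qed simp

text \<open>On scalars only the multidegree of a word matters, so by independence of monomial
  functions the coefficients in each multidegree sum to 0.\<close>

lemma sum_sorted_word_eq_0:
  fixes f :: "'k::field_char_0 fa"
  assumes "\<And>a. SC.ev a f = 0"
  shows "(\<Sum>w | coeff f w \<noteq> 0. Const (coeff f w) * sorted_word (mset w)) = 0"
proof -
  let ?W = "{w. coeff f w \<noteq> 0}"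
  have "(\<Sum>w\<in>{w\<in>?W. mset w = \<alpha>}. coeff f w) = 0" if "\<alpha> \<in> mset ` ?W" for \<alpha>
  proof (rule monomial_functions_independent[where M = "mset ` ?W"])
    fix a :: "nat \<Rightarrow> 'k"
    have "0 = (\<Sum>w\<in>?W. coeff f w * prod_mset (image_mset a (mset w)))"
      using assms[of a] by (simp add: SC.ev_def prod_list_map_mset)
    also have "\<dots> = (\<Sum>\<alpha>\<in>mset ` ?W. \<Sum>w\<in>{w\<in>?W. mset w = \<alpha>}. coeff f w * prod_mset (image_mset a (mset w)))"
      by (rule sum.image_gen) simp
    finally show "(\<Sum>\<alpha>\<in>mset ` ?W. (\<Sum>w\<in>{w\<in>?W. mset w = \<alpha>}. coeff f w) * prod_mset (image_mset a \<alpha>)) = 0"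
      by (simp add: sum_distrib_right)
  qed (use that in auto)
  moreover have "(\<Sum>w\<in>?W. Const (coeff f w) * sorted_word (mset w)) =
    (\<Sum>\<alpha>\<in>mset ` ?W. \<Sum>w\<in>{w\<in>?W. mset w = \<alpha>}. Const (coeff f w) * sorted_word (mset w))"
    by (rule sum.image_gen) simp
  moreover have "(\<Sum>w\<in>{w\<in>?W. mset w = \<alpha>}. Const (coeff f w) * sorted_word (mset w)) =
    Const (\<Sum>w\<in>{w\<in>?W. mset w = \<alpha>}. coeff f w) * sorted_word \<alpha>" for \<alpha>
  proof -
    have "Const (sum h A) = (\<Sum>x\<in>A. Const (h x :: 'k))" for h and A :: "nat list set"
      by (rule fa_eqI) simp
    then show ?thesis by (simp add: sum_distrib_right)
  qed
  ultimately show ?thesis by simp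
qed

lemma fa_expand_word: "f = (\<Sum>w | coeff f w \<noteq> 0. Const (coeff f w) * word w)"
  by (rule trans[OF fa_expand]) (intro sum.cong refl mono_eq)

text \<open>Sorting every word changes \<open>f\<close> by an element of the commutator ideal, and
  the sorted sum vanishes.\<close>

lemma comm_ideal_kernel:
  fixes f :: "'k::field_char_0 fa"
  assumes "\<And>a. SC.ev a f = 0"
  shows "f \<in> comm_ideal"
proof -
  have "f = (\<Sum>w | coeff f w \<noteq> 0. Const (coeff f w) * word w) -
      (\<Sum>w | coeff f w \<noteq> 0. Const (coeff f w) * sorted_word (mset w))"
    using sum_sorted_word_eq_0[OF assms] fa_expand_word[of f] by simp
  also have "\<dots> = (\<Sum>w | coeff f w \<noteq> 0. Const (coeff f w) * (word w - sorted_word (mset w)))"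
    by (simp add: sum_subtractf right_diff_distrib)
  also have "\<dots> \<in> comm_ideal"
    unfolding sorted_word_def
    by (intro comm_ideal_sum comm_ideal_lmult word_diff_comm_ideal) simp
  finally show ?thesis .
qed

section \<open>Fox derivatives\<close>

text \<open>For \<open>y = (\<alpha>, i)\<close>, \<open>fox f y\<close> collects the words \<open>v'\<close> over all factorisations \<open>v x\<^sub>i v'\<close> of the
  words of \<open>f\<close> in which \<open>v\<close> has multidegree \<open>\<alpha>\<close>.\<close>

definition occs :: "'k::comm_ring_1 fa \<Rightarrow> (nat list \<times> nat) set" where
  "occs f = (SIGMA w:{w. coeff f w \<noteq> 0}. {..<length w})"

definition key :: "nat list \<times> nat \<Rightarrow> nat multiset \<times> nat" where
  "key = (\<lambda>(w, k). (mset (take k w), w ! k))"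

definition fox :: "'k::comm_ring_1 fa \<Rightarrow> nat multiset \<times> nat \<Rightarrow> 'k fa" where
  "fox f y = (\<Sum>(w, k)\<in>{p \<in> occs f. key p = y}. Const (coeff f w) * word (drop (Suc k) w))"

lemma finite_occs [simp]: "finite (occs f)"
  by (simp add: occs_def)

text \<open>\<open>word_telescope\<close> with empty prefix, applied to all words of
  \<open>f\<close>: the fully sorted part cancels, and the remaining terms are grouped by their left
  factor.\<close>

lemma fox_expansion:
  fixes f :: "'k::field_char_0 fa"
  assumes "\<And>a. SC.ev a f = 0"
  shows "f = (\<Sum>y\<in>key ` occs f. step y * fox f y)"
proof -
  have w: "word w = sorted_word (mset w) +
      (\<Sum>k<length w. step (key (w, k)) * word (drop (Suc k) w) :: 'k fa)" for w
    using word_telescope[of "{#}" w] by (simp add: key_def sorted_word_def)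
  have "f = (\<Sum>w | coeff f w \<noteq> 0. Const (coeff f w) * word w)"
    by (rule fa_expand_word)
  also have "\<dots> = (\<Sum>w | coeff f w \<noteq> 0. Const (coeff f w) * sorted_word (mset w)) +
    (\<Sum>w | coeff f w \<noteq> 0. \<Sum>k<length w. Const (coeff f w) * (step (key (w, k)) * word (drop (Suc k) w)))"
    by (subst w) (simp add: distrib_left sum.distrib sum_distrib_left)
  also have "\<dots> = (\<Sum>(w, k)\<in>occs f. Const (coeff f w) * (step (key (w, k)) * word (drop (Suc k) w)))"
    unfolding sum_sorted_word_eq_0[OF assms] occs_def by (simp add: sum.Sigma)
  also have "\<dots> = (\<Sum>p\<in>occs f. step (key p) * (case p of (w, k) \<Rightarrow> Const (coeff f w) * word (drop (Suc k) w)))"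
    by (intro sum.cong refl) (clarsimp, metis Const_central mult.assoc)
  also have "\<dots> = (\<Sum>y\<in>key ` occs f. \<Sum>p\<in>{p \<in> occs f. key p = y}.
      step (key p) * (case p of (w, k) \<Rightarrow> Const (coeff f w) * word (drop (Suc k) w)))"
    by (rule sum.image_gen) simp
  also have "\<dots> = (\<Sum>y\<in>key ` occs f. step y * fox f y)"
    by (simp add: fox_def sum_distrib_left)
  finally show ?thesis .
qed

text \<open>A contribution to the upper right corner crosses from the first row to the second at
  exactly one letter, necessarily \<open>i\<close>: the letters before it take values in
  \<open>a\<close>, those after it in \<open>d\<close>.\<close>

lemma tb_prod_list:
  assumes "\<And>j. Z j = Tri (gconst (a j)) (if j = i then 1 else 0) (d j)"
  shows "tb (prod_list (map Z w)) =
    (\<Sum>k<length w. if w ! k = i then gconst (prod_list (map a (take k w))) * prod_list (map d (drop (Suc k) w)) else 0)"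
proof (induction w)
  case (Cons j w)
  have td: "td (prod_list (map Z w)) = prod_list (map d w)"
    by (induction w) (simp_all add: assms)
  have "(\<Sum>k<length w. if w ! k = i then gconst (prod_list (map a (take (Suc k) (j # w)))) *
      prod_list (map d (drop (Suc (Suc k)) (j # w))) else 0) = gconst (a j) * tb (prod_list (map Z w))"
    unfolding Cons sum_distrib_left by (intro sum.cong refl) (simp add: GR.hom_mult mult.assoc)
  then show ?case
    by (simp add: assms[of j] td sum.lessThan_Suc_shift GR.hom_1 del: sum.lessThan_Suc)
qed simp

text \<open>The upper right corner is a polynomial in the scalars \<open>a\<close> whose
  coefficients are the values of the Fox derivatives for \<open>i\<close>. Fixing a Grassmann
  coefficient \<open>S\<close> makes them scalars, and varying \<open>a\<close> separates the
  multidegrees.\<close>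

lemma fox_vanishes:
  fixes f :: "'k::field_char_0 fa"
  assumes "\<And>a i. tb (TR.ev (\<lambda>j. Tri (gconst (a j)) (if j = i then 1 else 0) (d j)) f) = 0"
    and y: "y \<in> key ` occs f"
  shows "GR.ev d (fox f y) = 0"
proof (rule gr_eqI)
  fix S :: "nat set"
  obtain \<alpha> i where yi: "y = (\<alpha>, i)" by force
  let ?P = "{p \<in> occs f. snd (key p) = i}"
  define t where "t p = (case p of (w, k) \<Rightarrow> coeff f w * gcoeff (prod_list (map d (drop (Suc k) w))) S)" for p
  have ev: "gcoeff (GR.ev d (fox f (\<beta>, i))) S = (\<Sum>p\<in>{p\<in>?P. fst (key p) = \<beta>}. t p)" for \<beta>
  proof -
    have "{p \<in> occs f. key p = (\<beta>, i)} = {p\<in>?P. fst (key p) = \<beta>}" by auto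
    then show ?thesis
      unfolding fox_def by (simp add: t_def case_prod_unfold comp_def)
  qed
  have "(\<Sum>p\<in>{p\<in>?P. fst (key p) = \<alpha>}. t p) = 0"
  proof (rule monomial_functions_independent[where M = "(\<lambda>p. fst (key p)) ` ?P"])
    fix a :: "nat \<Rightarrow> 'k"
    define Z where "Z j = Tri (gconst (a j)) (if j = i then 1 else 0) (d j)" for j
    have tb_sum: "tb (sum h A) = (\<Sum>x\<in>A. tb (h x))" for h :: "nat list \<Rightarrow> 'k tri" and A
      by (induction A rule: infinite_finite_induct) simp_all
    have "0 = gcoeff (tb (TR.ev Z f)) S"
      using assms(1)[of a i] by (simp add: Z_def[abs_def])
    also have "\<dots> = (\<Sum>w | coeff f w \<noteq> 0. \<Sum>k<length w.
        if w ! k = i then t (w, k) * prod_list (map a (take k w)) else 0)"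
      unfolding TR.ev_def tb_sum gcoeff_sum
      by (intro sum.cong refl)
        (simp add: tconst_def tb_prod_list[of Z, OF Z_def] t_def sum_distrib_left,
          intro sum.cong refl, simp add: t_def mult_ac)
    also have "\<dots> = (\<Sum>p\<in>occs f. if snd (key p) = i then t p * prod_mset (image_mset a (fst (key p))) else 0)"
      unfolding occs_def by (simp add: sum.Sigma, intro sum.cong refl) (auto simp: key_def prod_list_map_mset)
    also have "\<dots> = (\<Sum>p\<in>?P. t p * prod_mset (image_mset a (fst (key p))))"
      by (simp add: sum.inter_filter)
    also have "\<dots> = (\<Sum>\<alpha>\<in>(\<lambda>p. fst (key p)) ` ?P. \<Sum>p\<in>{p\<in>?P. fst (key p) = \<alpha>}.
        t p * prod_mset (image_mset a (fst (key p))))"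
      by (rule sum.image_gen) simp
    finally show "(\<Sum>\<alpha>\<in>(\<lambda>p. fst (key p)) ` ?P. (\<Sum>p\<in>{p\<in>?P. fst (key p) = \<alpha>}. t p) *
        prod_mset (image_mset a \<alpha>)) = 0"
      by (simp add: sum_distrib_right)
  next
    from y yi obtain p where "p \<in> occs f" "key p = (\<alpha>, i)" by auto
    then show "\<alpha> \<in> (\<lambda>p. fst (key p)) ` ?P" by force
  qed simp
  then show "gcoeff (GR.ev d (fox f y)) S = gcoeff 0 S"
    by (simp add: ev yi)
qed

section \<open>Normal form modulo triple commutators\<close>

inductive_set triple_ideal :: "'k::comm_ring_1 fa set" where
  triple: "p * comm (comm a b) c * q \<in> triple_ideal"
| add: "f \<in> triple_ideal \<Longrightarrow> g \<in> triple_ideal \<Longrightarrow> f + g \<in> triple_ideal"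

lemma triple_ideal_0: "0 \<in> triple_ideal"
  using triple_ideal.triple[of 0] by simp

lemma triple_ideal_lmult: "f \<in> triple_ideal \<Longrightarrow> h * f \<in> triple_ideal"
  by (induction rule: triple_ideal.induct)
    (simp_all add: distrib_left triple_ideal.add triple_ideal.triple flip: mult.assoc)

lemma triple_ideal_rmult: "f \<in> triple_ideal \<Longrightarrow> f * h \<in> triple_ideal"
proof (induction rule: triple_ideal.induct)
  case (triple p a b c q)
  then show ?case using triple_ideal.triple[of p a b c "q * h"] by (simp add: mult.assoc)
qed (simp add: distrib_right triple_ideal.add)

lemma triple_ideal_uminus: "f \<in> triple_ideal \<Longrightarrow> - f \<in> triple_ideal"
  using triple_ideal_lmult[of f "- 1"] by simp

lemma triple_ideal_diff: "f \<in> triple_ideal \<Longrightarrow> g \<in> triple_ideal \<Longrightarrow> f - g \<in> triple_ideal"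
  using triple_ideal.add[of f "- g"] triple_ideal_uminus[of g] by simp

lemma triple_in_ideal: "comm (comm a b) c \<in> triple_ideal"
  using triple_ideal.triple[of 1 a b c 1] by simp

text \<open>Expand \<open>[[a d, c], b]\<close> by Leibniz: apart from multiples of triple
  commutators, only two products of commutators remain.\<close>

lemma triple_ideal_exchange:
  "comm a b * comm c d + comm a c * comm b d \<in> triple_ideal"
proof -
  have "a * comm (comm d c) b + comm (comm a c) b * d - comm (comm (a * d) c) b \<in> triple_ideal"
    by (intro triple_ideal.add triple_ideal_diff triple_ideal_lmult triple_ideal_rmult triple_in_ideal)
  also have "a * comm (comm d c) b + comm (comm a c) b * d - comm (comm (a * d) c) b =
      comm a b * comm c d + comm a c * comm b d"
    by (simp add: comm_def algebra_simps)
  finally show ?thesis .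
qed

text \<open>The value 0 on lists of odd length lets \<open>pair_comm_swap\<close> hold without a
  parity condition.\<close>

fun pair_comm :: "'r::ring_1 list \<Rightarrow> 'r" where
  "pair_comm [] = 1"
| "pair_comm [x] = 0"
| "pair_comm (x # y # l) = comm x y * pair_comm l"

text \<open>The two neighbours either form one commutator, which is antisymmetric, or lie in
  adjacent commutators, where \<open>triple_ideal_exchange\<close> applies.\<close>

lemma pair_comm_swap:
  "pair_comm (xs @ a # b # ys) + pair_comm (xs @ b # a # ys) \<in> (triple_ideal :: 'k::comm_ring_1 fa set)"
proof (induction xs rule: pair_comm.induct)
  case 1
  have "comm a b * pair_comm ys + comm b a * pair_comm ys = 0"
    by (simp add: comm_def algebra_simps)
  then show ?case by (simp add: triple_ideal_0)
next
  case (2 x)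
  show ?case
  proof (cases ys)
    case (Cons y zs)
    have "(comm x a * comm b y + comm x b * comm a y) * pair_comm zs \<in> triple_ideal"
      by (intro triple_ideal_rmult triple_ideal_exchange)
    with Cons show ?thesis by (simp add: distrib_right mult.assoc)
  qed (simp add: triple_ideal_0)
next
  case (3 x y l)
  then show ?case using triple_ideal_lmult by (simp flip: distrib_left)
qed

text \<open>Congruence up to sign, which avoids tracking the sign of the sorting
  permutation.\<close>

definition pm_cong :: "'k::comm_ring_1 fa \<Rightarrow> 'k fa \<Rightarrow> bool" where
  "pm_cong x y \<longleftrightarrow> x - y \<in> triple_ideal \<or> x + y \<in> triple_ideal"

lemma pm_cong_trans: "pm_cong x y \<Longrightarrow> pm_cong y z \<Longrightarrow> pm_cong x z"
proof -
  assume "pm_cong x y" "pm_cong y z"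
  then consider "x - y \<in> triple_ideal" "y - z \<in> triple_ideal" | "x - y \<in> triple_ideal" "y + z \<in> triple_ideal"
    | "x + y \<in> triple_ideal" "y - z \<in> triple_ideal" | "x + y \<in> triple_ideal" "y + z \<in> triple_ideal"
    unfolding pm_cong_def by blast
  then show ?thesis
  proof cases
    case 1 from triple_ideal.add[OF this] show ?thesis by (simp add: pm_cong_def)
  next
    case 2 from triple_ideal.add[OF this] show ?thesis by (simp add: pm_cong_def)
  next
    case 3 from triple_ideal_diff[OF this] show ?thesis by (simp add: pm_cong_def)
  next
    case 4 from triple_ideal_diff[OF this] show ?thesis by (simp add: pm_cong_def)
  qed
qed

lemma pm_cong_refl: "pm_cong x x"
  by (simp add: pm_cong_def triple_ideal_0)

definition cl :: "nat list \<Rightarrow> 'k::comm_ring_1 fa" where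
  "cl l = pair_comm (map Var l)"

lemma cl_swap: "cl (xs @ a # b # ys) + cl (xs @ b # a # ys) \<in> (triple_ideal :: 'k::comm_ring_1 fa set)"
  by (simp add: cl_def pair_comm_swap)

lemma cl_insort: "pm_cong (cl (xs @ x # l) :: 'k::comm_ring_1 fa) (cl (xs @ insort x l))"
proof (induction l arbitrary: xs)
  case (Cons y l)
  show ?case
  proof (cases "x \<le> y")
    case False
    have "pm_cong (cl (xs @ x # y # l) :: 'k fa) (cl (xs @ y # x # l))"
      unfolding pm_cong_def using cl_swap by blast
    moreover have "pm_cong (cl (xs @ y # x # l) :: 'k fa) (cl (xs @ y # insort x l))"
      using Cons[of "xs @ [y]"] by simp
    ultimately show ?thesis using False by (auto intro: pm_cong_trans)
  qed (simp add: pm_cong_refl)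
qed (simp add: pm_cong_refl)

lemma cl_sort: "pm_cong (cl (xs @ l) :: 'k::comm_ring_1 fa) (cl (xs @ sort l))"
proof (induction l arbitrary: xs)
  case (Cons y l)
  have "pm_cong (cl (xs @ y # l) :: 'k fa) (cl (xs @ y # sort l))"
    using Cons[of "xs @ [y]"] by simp
  then show ?case using cl_insort pm_cong_trans by fastforce
qed (simp add: pm_cong_refl)

lemma sorted_not_distinct_adjacent:
  "sorted l \<Longrightarrow> \<not> distinct l \<Longrightarrow> \<exists>xs a ys. l = xs @ a # a # ys"
proof (induction l)
  case (Cons x l)
  show ?case
  proof (cases "x \<in> set l")
    case True
    then obtain y ys where l: "l = y # ys" by (cases l) auto
    with Cons.prems True have "x = y" by (auto simp: order.antisym)
    with l show ?thesis by (intro exI[of _ "[]"]) simp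
  next
    case False
    with Cons obtain xs a ys where "l = xs @ a # a # ys" by auto
    then show ?thesis by (intro exI[of _ "x # xs"]) simp
  qed
qed simp

text \<open>Swapping two equal neighbours puts \<open>cl l + cl l\<close> into the ideal, and 2 is
  invertible.\<close>

lemma cl_not_distinct:
  assumes "sorted l" "\<not> distinct l"
  shows "cl l \<in> (triple_ideal :: 'k::field_char_0 fa set)"
proof -
  obtain xs a ys where l: "l = xs @ a # a # ys"
    using sorted_not_distinct_adjacent assms by blast
  have "Const (1 / 2) * (cl l + cl l) \<in> (triple_ideal :: 'k fa set)"
    unfolding l by (intro triple_ideal_lmult cl_swap)
  moreover have "Const (1 / 2) * (cl l + cl l) = (cl l :: 'k fa)"
  proof -
    have "Const (1 / 2) + Const (1 / 2) = (1 :: 'k fa)"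
      by (simp flip: mono_add)
    then show ?thesis by (simp add: distrib_left flip: distrib_right)
  qed
  ultimately show ?thesis by simp
qed

text \<open>This is \<open>J + C\<^sup>m\<close>, where \<open>J\<close> is the ideal of triple commutators and \<open>C\<close> the commutator ideal.\<close>

inductive_set comm_level :: "nat \<Rightarrow> 'k::comm_ring_1 fa set" for m where
  ideal: "f \<in> triple_ideal \<Longrightarrow> f \<in> comm_level m"
| cl: "length l = 2 * m \<Longrightarrow> p * cl l \<in> comm_level m"
| add: "f \<in> comm_level m \<Longrightarrow> g \<in> comm_level m \<Longrightarrow> f + g \<in> comm_level m"

lemma comm_level_sum: "(\<And>x. x \<in> A \<Longrightarrow> h x \<in> comm_level m) \<Longrightarrow> sum h A \<in> comm_level m"
  by (induction A rule: infinite_finite_induct)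
    (auto intro: comm_level.add comm_level.ideal triple_ideal_0)

text \<open>Each list is sorted up to sign, and lists with a repeated letter disappear modulo triple
  commutators.\<close>

lemma comm_level_normal_form:
  fixes g :: "'k::field_char_0 fa"
  assumes "g \<in> comm_level m"
  shows "\<exists>T p. finite T \<and> T \<subseteq> {l. sorted l \<and> distinct l \<and> length l = 2 * m} \<and>
    g - (\<Sum>l\<in>T. p l * cl l) \<in> triple_ideal"
  using assms
proof (induction rule: comm_level.induct)
  case (ideal f)
  then show ?case by (intro exI[of _ "{}"]) simp
next
  case (cl l p)
  show ?case
  proof (cases "distinct l")
    case True
    consider "cl l - cl (sort l) \<in> (triple_ideal :: 'k fa set)" | "cl l + cl (sort l) \<in> (triple_ideal :: 'k fa set)"
      using cl_sort[of "[]" l] by (auto simp: pm_cong_def)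
    then obtain q where "p * cl l - q * cl (sort l) \<in> triple_ideal"
    proof cases
      case 1
      from triple_ideal_lmult[OF this, of p] that[of p] show ?thesis by (simp add: right_diff_distrib)
    next
      case 2
      from triple_ideal_lmult[OF this, of p] that[of "- p"] show ?thesis by (simp add: distrib_left)
    qed
    with True cl show ?thesis by (intro exI[of _ "{sort l}"] exI[of _ "\<lambda>_. q"]) simp
  next
    case False
    then have "cl (sort l) \<in> (triple_ideal :: 'k fa set)"
      by (intro cl_not_distinct) simp_all
    moreover have "pm_cong (cl l) (cl (sort l) :: 'k fa)" using cl_sort[of "[]" l] by simp
    ultimately have "cl l \<in> (triple_ideal :: 'k fa set)"
      using triple_ideal.add triple_ideal_diff unfolding pm_cong_def
      by (metis add_diff_cancel diff_add_cancel)
    then show ?thesis by (intro exI[of _ "{}"]) (simp add: triple_ideal_lmult)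
  qed
next
  case (add f g)
  then obtain T p T' p' where *: "finite T" "finite T'"
    "T \<subseteq> {l. sorted l \<and> distinct l \<and> length l = 2 * m}" "T' \<subseteq> {l. sorted l \<and> distinct l \<and> length l = 2 * m}"
    "f - (\<Sum>l\<in>T. p l * cl l) \<in> triple_ideal" "g - (\<Sum>l\<in>T'. p' l * cl l) \<in> triple_ideal"
    by blast
  define q where "q l = (if l \<in> T then p l else 0) + (if l \<in> T' then p' l else 0)" for l
  have "(\<Sum>l\<in>T \<union> T'. q l * cl l) =
    (\<Sum>l\<in>T \<union> T'. if l \<in> T then p l * cl l else 0) + (\<Sum>l\<in>T \<union> T'. if l \<in> T' then p' l * cl l else 0)"
    by (simp add: q_def distrib_right if_distrib[of "\<lambda>x. x * _"] sum.distrib cong: if_cong)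
  also have "\<dots> = (\<Sum>l\<in>T. p l * cl l) + (\<Sum>l\<in>T'. p' l * cl l)"
    using *(1,2) by (simp add: Int_absorb1 Int_absorb2 flip: sum.inter_restrict)
  finally have "f + g - (\<Sum>l\<in>T \<union> T'. q l * cl l) \<in> triple_ideal"
    using triple_ideal.add[OF *(5,6)] by (simp add: algebra_simps)
  with * show ?case by (intro exI[of _ "T \<union> T'"] exI[of _ q]) simp
qed

text \<open>On a word, Leibniz gives terms with one letter differentiated. Values of
  \<open>D\<close> are central modulo triple commutators, so this factor moves right until it meets
  \<open>t\<close>; only \<open>D\<close> on variables has to be checked.\<close>

lemma derivation_comm_level:
  assumes add: "\<And>x y. D (x + y) = D x + D y" and const: "\<And>c. D (Const c) = 0"
    and leibniz: "\<And>x y. D (x * y) = x * D y + D x * y"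
    and central: "\<And>x z. D x * z - z * D x \<in> triple_ideal"
    and var: "\<And>a i. a * D (Var i) * t \<in> comm_level m"
  shows "a * D f * t \<in> comm_level m"
proof (induction f arbitrary: a rule: fa_induct)
  case zero
  have "D 0 = 0" using const[of 0] by simp
  then show ?case by (simp add: comm_level.ideal triple_ideal_0)
next
  case (mono c w)
  show ?case
  proof (induction w arbitrary: a)
    case Nil
    then show ?case by (simp add: const comm_level.ideal triple_ideal_0)
  next
    case (Cons i w)
    let ?M = "Mono c w"
    have "a * (D (Var i) * ?M - ?M * D (Var i)) * t \<in> comm_level m"
      by (intro comm_level.ideal triple_ideal_lmult triple_ideal_rmult central)
    then have "a * Var i * D ?M * t + a * ?M * D (Var i) * t + a * (D (Var i) * ?M - ?M * D (Var i)) * t \<in> comm_level m"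
      by (intro comm_level.add Cons var)
    moreover have "a * Var i * D ?M * t + a * ?M * D (Var i) * t + a * (D (Var i) * ?M - ?M * D (Var i)) * t =
        a * D (Mono c (i # w)) * t"
      by (simp add: mono_Cons leibniz algebra_simps)
    ultimately show ?case by simp
  qed
next
  case (add f g)
  then show ?case
    using comm_level.add[OF add.IH] by (simp add: assms(1) algebra_simps)
qed

text \<open>Commutation is a derivation in each argument. Two uses of
  \<open>derivation_comm_level\<close> reduce \<open>comm q r\<close> to a commutator of two
  variables, which lengthens \<open>l\<close> by one pair.\<close>

lemma comm_level_Suc:
  assumes "length l = 2 * m" "f \<in> comm_ideal"
  shows "f * cl l \<in> comm_level (Suc m)"
  using assms(2)
proof (induction rule: comm_ideal.induct)
  case (comm p q r)
  have c: "comm (Const k) y = 0" "comm y (Const k) = 0" for k and y :: "'a fa"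
    using Const_central[of k y] by (simp_all add: comm_def)
  have central: "comm x y * z - z * comm x y \<in> triple_ideal" for x y z :: "'a fa"
    using triple_in_ideal[of x y z] by (simp add: comm_def[of "comm x y"])
  have 1: "a * comm (Var i) f * cl l \<in> comm_level (Suc m)" for a i and f :: "'a fa"
  proof (rule derivation_comm_level[of "comm (Var i)"])
    show "comm (Var i) x * z - z * comm (Var i) x \<in> triple_ideal" for x z :: "'a fa" by (rule central)
    show "a * comm (Var i) (Var j) * cl l \<in> comm_level (Suc m)" for a :: "'a fa" and j
      using comm_level.cl[of "i # j # l" "Suc m" a] assms(1) by (simp add: cl_def mult.assoc)
  qed (simp_all add: c, simp_all add: comm_def algebra_simps)
  show ?case
  proof (rule derivation_comm_level[of "\<lambda>x. comm x r"])
    show "comm x r * z - z * comm x r \<in> triple_ideal" for x z by (rule central)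
    show "a * comm (Var i) r * cl l \<in> comm_level (Suc m)" for a i by (rule 1)
  qed (simp_all add: c, simp_all add: comm_def algebra_simps)
qed (simp add: distrib_right comm_level.add)

section \<open>Identities of finite-dimensional Grassmann algebras\<close>

text \<open>Only values of the form scalar plus at most one generator are tested; these are the
  lower right entries realised in \<open>rank_identity_tri\<close>.\<close>

definition grass_identity :: "nat \<Rightarrow> 'k::comm_ring_1 fa \<Rightarrow> bool" where
  "grass_identity n g \<longleftrightarrow> (\<forall>\<xi> \<theta>. (\<forall>j. \<theta> j \<in> insert 0 (gen ` {..<n})) \<longrightarrow>
     GR.ev (\<lambda>j. gconst (\<xi> j) + \<theta> j) g = 0)"

lemma ev_triple_ideal: "f \<in> triple_ideal \<Longrightarrow> GR.ev \<delta> f = 0"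
  by (induction rule: triple_ideal.induct) (simp_all add: comm_comm_gr)

text \<open>By \<open>comm_parity\<close> each commutator of two values is twice the product of
  their odd parts.\<close>

lemma ev_cl:
  fixes \<theta> :: "nat \<Rightarrow> 'k::comm_ring_1 gr"
  assumes "\<And>j. godd (\<theta> j)" "length l = 2 * m"
  shows "GR.ev (\<lambda>j. gconst (\<xi> j) + \<theta> j) (cl l) = gconst (2 ^ m) * prod_list (map \<theta> l)"
  using assms(2)
proof (induction m arbitrary: l)
  case 0
  then show ?case by (simp add: cl_def GR.hom_1)
next
  case (Suc m)
  then obtain i j l' where l: "l = i # j # l'" "length l' = 2 * m"
    by (auto simp: length_Suc_conv)
  have "gconst 2 = (1 + 1 :: 'k gr)"
    using GR.hom_add[of "1::'k" 1] GR.hom_1[where ?'k = 'k] by simp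
  then have "comm (gconst (\<xi> i) + \<theta> i) (gconst (\<xi> j) + \<theta> j) = gconst 2 * (\<theta> i * \<theta> j)"
    using comm_parity[of "gconst (\<xi> i)" "\<theta> i" "gconst (\<xi> j)" "\<theta> j"] assms(1)
    by (simp add: distrib_right mult_2)
  then have "GR.ev (\<lambda>j. gconst (\<xi> j) + \<theta> j) (cl l) =
      gconst 2 * (\<theta> i * \<theta> j) * (gconst (2 ^ m) * prod_list (map \<theta> l'))"
    using Suc.IH[OF l(2)] by (simp add: cl_def l(1))
  also have "\<dots> = gconst 2 * gconst (2 ^ m) * (\<theta> i * \<theta> j * prod_list (map \<theta> l'))"
  proof -
    have "\<theta> i * \<theta> j * (gconst (2 ^ m) * x) = gconst (2 ^ m) * (\<theta> i * \<theta> j) * x" for x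
      by (simp only: GR.central[of "2 ^ m" "\<theta> i * \<theta> j"] mult.assoc)
    then show ?thesis by (simp add: mult.assoc)
  qed
  finally show ?case by (simp add: l(1) GR.hom_mult mult.assoc)
qed

text \<open>Sending the variables of a list \<open>l0\<close> to distinct odd generators kills every other term of the normal
  form and reduces the coefficient of \<open>cl l0\<close> to its value at the scalars \<open>\<xi>\<close>.\<close>

lemma grass_identity_level_step:
  fixes g :: "'k::field_char_0 fa"
  assumes g: "grass_identity n g" "g \<in> comm_level m" and m: "2 * m \<le> n"
  shows "g \<in> comm_level (Suc m)"
proof -
  obtain T p where T: "finite T" "T \<subseteq> {l. sorted l \<and> distinct l \<and> length l = 2 * m}"
    "g - (\<Sum>l\<in>T. p l * cl l) \<in> triple_ideal"
    using comm_level_normal_form[OF g(2)] by blast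
  \<comment> \<open>It suffices that every coefficient of the normal form lies in the commutator
    ideal, since such a factor raises the level of \<open>cl l\<close> by one.\<close>
  have "p l0 \<in> comm_ideal" if l0: "l0 \<in> T" for l0
  proof (rule comm_ideal_kernel)
    fix \<xi> :: "nat \<Rightarrow> 'k"
    have l0': "sorted l0" "distinct l0" "length l0 = 2 * m" using T(2) l0 by auto
    \<comment> \<open>The letter at position \<open>k\<close> of \<open>l0\<close> is sent to
      \<open>gen k\<close>; \<open>2 * m \<le> n\<close> keeps \<open>k\<close> below
      \<open>n\<close>.\<close>
    define idx where "idx = the_inv_into {..<length l0} ((!) l0)"
    have idx: "idx (l0 ! k) = k" if "k < length l0" for k
      unfolding idx_def using l0'(2) that by (intro the_inv_into_f_f) (auto simp: inj_on_nth)
    define \<theta> where "\<theta> j = (if j \<in> set l0 then gen (idx j) else 0 :: 'k gr)" for j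
    have \<theta>: "\<theta> j \<in> insert 0 (gen ` {..<n})" for j
      using idx m l0'(3) by (auto simp: \<theta>_def in_set_conv_nth)
    have odd: "godd (\<theta> j)" for j by (simp add: \<theta>_def)
    define \<omega> where "\<omega> = prod_list (map \<theta> l0)"
    have "map \<theta> l0 = map gen [0..<2 * m]"
      using idx l0'(3) by (intro nth_equalityI) (simp_all add: \<theta>_def)
    then have \<omega>: "gcoeff \<omega> {0..<2 * m} \<noteq> 0"
      using gcoeff_prod_gen_nonzero[of "[0..<2 * m]", where ?'k = 'k] by (simp add: \<omega>_def)
    have kill: "\<theta> j * \<omega> = 0" for j
    proof (cases "j \<in> set l0")
      case True
      then have "prod_list (map \<theta> (j # l0)) = 0"
        using odd by (intro godd_prod_list_repeated) auto
      then show ?thesis by (simp add: \<omega>_def)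
    qed (simp add: \<theta>_def)
    let ?\<delta> = "\<lambda>j. gconst (\<xi> j) + \<theta> j"
    \<comment> \<open>In front of \<open>\<omega>\<close> every \<open>\<theta> j\<close> dies, so
      only the scalar parts of the values survive.\<close>
    have scal: "GR.ev ?\<delta> f * \<omega> = gconst (SC.ev \<xi> f) * \<omega>" for f
    proof (induction f rule: fa_induct)
      case (mono c w)
      have "prod_list (map ?\<delta> w) * \<omega> = gconst (prod_list (map \<xi> w)) * \<omega>"
      proof (induction w)
        case (Cons j w)
        have "prod_list (map ?\<delta> (j # w)) * \<omega> = ?\<delta> j * (gconst (prod_list (map \<xi> w)) * \<omega>)"
          using Cons by (simp add: mult.assoc)
        also have "\<dots> = gconst (prod_list (map \<xi> w)) * (?\<delta> j * \<omega>)"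
          by (metis GR.central mult.assoc)
        also have "\<dots> = gconst (prod_list (map \<xi> w)) * (gconst (\<xi> j) * \<omega>)"
          by (simp add: distrib_right kill)
        also have "\<dots> = gconst (prod_list (map \<xi> (j # w))) * \<omega>"
          by (simp add: mult.assoc[symmetric] GR.hom_mult[symmetric] mult.commute)
        finally show ?case .
      qed (simp add: GR.hom_1)
      then show ?case by (simp add: GR.ev_mono SC.ev_mono GR.hom_mult mult.assoc)
    qed (simp_all add: GR.hom_0 GR.hom_add distrib_right)
    \<comment> \<open>Different strictly increasing lists of equal length have different letter sets
      of the same size, so \<open>l\<close> contains a letter outside \<open>l0\<close>, where
      \<open>\<theta>\<close> is 0.\<close>
    have other: "GR.ev ?\<delta> (p l * cl l) = 0" if l: "l \<in> T" "l \<noteq> l0" for l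
    proof -
      have l': "sorted l" "distinct l" "length l = 2 * m" using T(2) l by auto
      have "set l \<noteq> set l0" using l' l0' l(2) sorted_distinct_set_unique by blast
      moreover have "card (set l) = card (set l0)" using l' l0' by (simp add: distinct_card)
      ultimately obtain j where j: "j \<in> set l" "j \<notin> set l0"
        by (metis List.finite_set card_subset_eq subsetI)
      then have "0 \<in> set (map \<theta> l)" by (force simp: \<theta>_def)
      moreover have "0 \<in> set xs \<Longrightarrow> prod_list xs = 0" for xs :: "'k gr list"
        by (induction xs) auto
      ultimately show ?thesis using ev_cl[OF odd l'(3), of \<xi>] by simp
    qed
    have "GR.ev ?\<delta> g = 0" using g(1) \<theta> by (simp add: grass_identity_def)
    then have "GR.ev ?\<delta> (\<Sum>l\<in>T. p l * cl l) = 0"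
      using ev_triple_ideal[OF T(3), of ?\<delta>] by simp
    then have "(\<Sum>l\<in>T. GR.ev ?\<delta> (p l * cl l)) = 0" by (simp only: GR.ev_sum)
    moreover have "(\<Sum>l\<in>T. GR.ev ?\<delta> (p l * cl l)) = GR.ev ?\<delta> (p l0 * cl l0)"
      using T(1) l0 other by (simp add: sum.remove del: GR.ev_mult)
    ultimately have zero: "GR.ev ?\<delta> (p l0) * (gconst (2 ^ m) * \<omega>) = 0"
      using ev_cl[OF odd l0'(3), of \<xi>] by (simp add: \<omega>_def)
    have "gconst (2 ^ m) * (gconst (SC.ev \<xi> (p l0)) * \<omega>) = gconst (2 ^ m) * GR.ev ?\<delta> (p l0) * \<omega>"
      by (simp only: scal mult.assoc)
    also have "\<dots> = 0"
      using zero by (simp only: GR.central[of "2 ^ m"] mult.assoc)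
    \<comment> \<open>At this index the coefficient of \<open>\<omega>\<close> is non-zero, and so
      is \<open>2 ^ m\<close>; hence the scalar value must vanish.\<close>
    finally have "gcoeff (gconst (2 ^ m) * (gconst (SC.ev \<xi> (p l0)) * \<omega>)) {0..<2 * m} = 0" by simp
    with \<omega> show "SC.ev \<xi> (p l0) = 0" by simp
  qed
  then have "(\<Sum>l\<in>T. p l * cl l) \<in> comm_level (Suc m)"
    using T(2) by (intro comm_level_sum comm_level_Suc) auto
  then have "(g - (\<Sum>l\<in>T. p l * cl l)) + (\<Sum>l\<in>T. p l * cl l) \<in> comm_level (Suc m)"
    by (rule comm_level.add[OF comm_level.ideal[OF T(3)]])
  then show ?thesis by simp
qed

text \<open>Level 0 contains everything because \<open>cl []\<close> is the empty product; the step
  applies while \<open>2 * m \<le> n\<close>, for the last time at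
  \<open>m = n div 2\<close>.\<close>

lemma grass_identity_level:
  fixes g :: "'k::field_char_0 fa"
  assumes "grass_identity n g" "even n"
  shows "g \<in> comm_level (n div 2 + 1)"
proof -
  have "m \<le> n div 2 + 1 \<Longrightarrow> g \<in> comm_level m" for m
  proof (induction m)
    case 0
    show ?case using comm_level.cl[of "[]" 0 g] by (simp add: cl_def)
  next
    case (Suc m)
    then show ?case using assms by (intro grass_identity_level_step) auto
  qed
  then show ?thesis by simp
qed

section \<open>Identities of the relatively free algebra lie in the T-ideal\<close>

lemma prod_comm_eq_pair_comm:
  "prod_list (map (\<lambda>j. comm (\<phi> (2 * j)) (\<phi> (2 * j + 1))) [0..<k]) = pair_comm (map \<phi> [0..<2 * k])"
  for \<phi> :: "nat \<Rightarrow> 'r::ring_1"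
proof (induction k arbitrary: \<phi>)
  case (Suc k)
  have 1: "[0..<Suc k] = 0 # map Suc [0..<k]" by (simp add: map_Suc_upt upt_conv_Cons)
  have 2: "[0..<2 * Suc k] = 0 # 1 # map (\<lambda>i. Suc (Suc i)) [0..<2 * k]"
    by (simp add: upt_conv_Cons map_Suc_upt flip: map_map[of Suc Suc, unfolded comp_def])
  show ?case
    unfolding 1 2 using Suc[of "\<lambda>i. \<phi> (Suc (Suc i))"] by (simp add: comp_def)
qed simp

lemma T_ideal_pair_comm:
  assumes "T_ideal I" "gen2_fa n \<in> I" "length L = 2 * (n div 2 + 2)"
  shows "pair_comm L \<in> I"
proof -
  have "FA.ev (\<lambda>i. L ! i) (gen2_fa n) = pair_comm (map ((!) L) [0..<2 * (n div 2 + 2)])"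
    by (simp only: prod_comm_eq_pair_comm[symmetric] gen2_fa_def FA.ev_prod_list map_map comp_def
        FA.ev_comm FA.ev_Var)
  also have "\<dots> = pair_comm L"
    unfolding assms(3)[symmetric] map_nth ..
  finally show ?thesis using assms by (metis T_ideal_def)
qed

lemma T_ideal_comm_triple:
  assumes "T_ideal I" "gen1_fa \<in> I"
  shows "comm q r * comm (comm a b) c \<in> I"
proof -
  have "FA.ev (\<lambda>i. [q, r, a, b, c] ! i) gen1_fa = comm q r * comm (comm a b) c"
    by (simp add: gen1_fa_def)
  then show ?thesis using assms by (metis T_ideal_def)
qed

text \<open>The commutator ideal absorbs the multiplier \<open>p\<close> from the right. What
  remains is a commutator times a triple commutator, or a product of \<open>n div 2 + 2\<close>
  commutators, and both are substitution instances of the generators.\<close>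

lemma T_ideal_contains_comm_level:
  assumes I: "T_ideal I" "gen1_fa \<in> I" "gen2_fa n \<in> I"
    and "g \<in> comm_level (n div 2 + 1)" "h \<in> comm_ideal"
  shows "h * g \<in> I"
proof -
  have add: "\<And>x y. x \<in> I \<Longrightarrow> y \<in> I \<Longrightarrow> x + y \<in> I"
    and mult: "\<And>x y. x \<in> I \<Longrightarrow> y * x \<in> I" "\<And>x y. x \<in> I \<Longrightarrow> x * y \<in> I"
    using I(1) by (auto simp: T_ideal_def)
  have *: "h * t \<in> I" if "h \<in> comm_ideal" "\<And>q r. comm q r * t \<in> I" for h t
    using that(1) by (induction rule: comm_ideal.induct) (simp_all add: that(2) mult add distrib_right mult.assoc)
  have triple: "h * f \<in> I" if "f \<in> triple_ideal" "h \<in> comm_ideal" for f h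
    using that
  proof (induction arbitrary: h rule: triple_ideal.induct)
    case (triple p a b c q)
    have "(h * p) * comm (comm a b) c \<in> I"
      by (intro *[OF comm_ideal_rmult[OF triple.prems]] T_ideal_comm_triple[OF I(1,2)])
    from mult(2)[OF this, of q] show ?case by (simp add: mult.assoc)
  qed (simp add: distrib_left add)
  show ?thesis
    using assms(4,5)
  proof (induction arbitrary: h rule: comm_level.induct)
    case (ideal f)
    then show ?case by (rule triple)
  next
    case (cl l p)
    have "(h * p) * cl l \<in> I"
    proof (rule *)
      show "h * p \<in> comm_ideal" using cl by (rule_tac comm_ideal_rmult)
      show "comm q r * cl l \<in> I" for q r
        using T_ideal_pair_comm[OF I(1,3), of "q # r # map Var l"] cl by (simp add: cl_def)
    qed
    then show ?case by (simp add: mult.assoc)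
  qed (simp add: distrib_left add)
qed

section \<open>Evaluations available in rank \<open>n\<close>\<close>

lemma rank_identity_scalar:
  fixes f :: "'k::comm_ring_1 fa"
  assumes "rank_identity n f"
  shows "SC.ev a f = 0"
proof -
  have "TR.ev (\<lambda>i. tconst (a i)) f = tconst (SC.ev a f)"
  proof (induction f rule: fa_induct)
    case (mono c w)
    have "(\<Prod>i\<leftarrow>w. tconst (a i)) = tconst (prod_list (map a w))"
      by (induction w) (simp_all add: TR.hom_1 TR.hom_mult)
    then show ?case by (simp add: TR.ev_mono SC.ev_mono TR.hom_mult)
  qed (simp_all add: TR.hom_0 TR.hom_add)
  \<comment> \<open>Constant polynomials belong to \<open>vars_below n\<close> and evaluate to
    scalar matrices.\<close>
  moreover have "TR.ev (\<lambda>i. TR.ev (\<lambda>_. 1) (Const (a i))) f = 0"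
    using assms A_ring_closed(1) unfolding rank_identity_def by (metis vars_below_simps(1))
  ultimately have "tconst (SC.ev a f) = 0" by simp
  then have "gcoeff (gconst (SC.ev a f)) {} = 0" by (simp add: tconst_def tri_eq_iff)
  then show ?thesis by (simp add: gconst.rep_eq)
qed

text \<open>The subalgebra generated by \<open>(1, 0, e\<^sub>0)\<close>, \<open>(0, 1, e\<^sub>1)\<close> and the \<open>(0, 0, e\<^sub>k)\<close> contains the
  idempotent \<open>(1, 0, e\<^sub>0)\<^sup>2 = (1, 0, 0)\<close>, hence all triples below.\<close>

lemma rank_identity_tri:
  fixes f :: "'k::field_char_0 fa"
  assumes "rank_identity n f" "n \<ge> 2" "\<And>j. \<theta> j \<in> insert 0 (gen ` {..<n})"
  shows "TR.ev (\<lambda>j. Tri (gconst (a j)) (if j = i then 1 else 0) (gconst (\<xi> j) + \<theta> j)) f = 0"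
proof -
  define Y :: "nat \<Rightarrow> 'k tri" where
    "Y k = Tri (if k = 0 then 1 else 0) (if k = 1 then 1 else 0) (gen k)" for k
  define \<epsilon> :: "'k fa" where "\<epsilon> = Var 0 * Var 0"
  \<comment> \<open>Since \<open>\<epsilon>\<close> evaluates to \<open>(1, 0, 0)\<close>,
    multiplying by \<open>1 - \<epsilon>\<close> on both sides isolates the lower right
    entry.\<close>
  have "\<forall>j. \<exists>q. q \<in> vars_below n \<and> TR.ev Y ((1 - \<epsilon>) * q * (1 - \<epsilon>)) = Tri 0 0 (\<theta> j)"
  proof
    fix j
    show "\<exists>q. q \<in> vars_below n \<and> TR.ev Y ((1 - \<epsilon>) * q * (1 - \<epsilon>)) = Tri 0 0 (\<theta> j)"
    proof (cases "\<theta> j = 0")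
      case True
      then show ?thesis by (intro exI[of _ 0]) (simp add: tri_eq_iff)
    next
      case False
      then obtain k where "k < n" "\<theta> j = gen k" using assms(3)[of j] by auto
      then show ?thesis
        by (intro exI[of _ "Var k"]) (simp add: tri_eq_iff \<epsilon>_def Y_def godd_square)
    qed
  qed
  then obtain q where q: "\<And>j. q j \<in> vars_below n"
    "\<And>j. TR.ev Y ((1 - \<epsilon>) * q j * (1 - \<epsilon>)) = Tri 0 0 (\<theta> j)"
    by metis
  \<comment> \<open>The summands produce, in order, the upper left entry, the upper right entry, and
    the scalar and odd parts of the lower right entry. The presence of \<open>Var 1\<close> calls
    for \<open>n \<ge> 2\<close>.\<close>
  define \<phi> where "\<phi> j = Const (a j) * \<epsilon> + (if j = i then \<epsilon> * Var 1 * (1 - \<epsilon>) else 0) +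
    Const (\<xi> j) * (1 - \<epsilon>) + (1 - \<epsilon>) * q j * (1 - \<epsilon>)" for j
  have "\<phi> j \<in> vars_below n" for j
    using q(1) assms(2) unfolding \<phi>_def \<epsilon>_def
    by (auto intro!: vars_below_add vars_below_mult vars_below_diff)
  moreover have "Y k \<in> A_ring" for k by (simp add: Y_def A_ring_def)
  ultimately have "TR.ev (\<lambda>j. TR.ev Y (\<phi> j)) f = 0"
    using assms(1) by (simp add: rank_identity_def)
  moreover have "TR.ev Y (\<phi> j) = Tri (gconst (a j)) (if j = i then 1 else 0) (gconst (\<xi> j) + \<theta> j)" for j
  proof -
    have "TR.ev Y \<epsilon> = Tri 1 0 0" by (simp add: \<epsilon>_def Y_def tri_eq_iff godd_square)
    moreover have "TR.ev Y (Var 1) = Tri 0 1 (gen 1)" by (simp add: Y_def)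
    ultimately show ?thesis
      unfolding \<phi>_def TR.ev_add q(2) by (simp add: tri_eq_iff tconst_def del: One_nat_def)
  qed
  ultimately show ?thesis by simp
qed

lemma rank_identity_in_T_ideal:
  fixes f :: "'k::field_char_0 fa"
  assumes f: "rank_identity n f" and n: "even n" "n \<ge> 1"
    and I: "T_ideal I" "gen1_fa \<in> I" "gen2_fa n \<in> I"
  shows "f \<in> I"
proof -
  have n2: "n \<ge> 2" using n by presburger
  \<comment> \<open>The matrices of \<open>rank_identity_tri\<close> have freely chosen scalars
    \<open>a\<close> and crossing letter \<open>i\<close>, as \<open>fox_vanishes\<close>
    requires.\<close>
  have "grass_identity n (fox f y)" if "y \<in> key ` occs f" for y
    unfolding grass_identity_def
  proof (intro allI impI)
    fix \<xi> :: "nat \<Rightarrow> 'k" and \<theta> :: "nat \<Rightarrow> 'k gr"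
    assume "\<forall>j. \<theta> j \<in> insert 0 (gen ` {..<n})"
    then show "GR.ev (\<lambda>j. gconst (\<xi> j) + \<theta> j) (fox f y) = 0"
      using rank_identity_tri[OF f n2] that by (intro fox_vanishes) (simp_all del: insert_iff)
  qed
  then have mem: "step y * fox f y \<in> I" if "y \<in> key ` occs f" for y
    using that n(1) by (intro T_ideal_contains_comm_level[OF I] grass_identity_level step_comm_ideal)
  have sum: "sum h A \<in> I" if "\<And>y. y \<in> A \<Longrightarrow> h y \<in> I" for h and A :: "(nat multiset \<times> nat) set"
    using that I(1) by (induction A rule: infinite_finite_induct) (auto simp: T_ideal_def)
  have "(\<Sum>y\<in>key ` occs f. step y * fox f y) \<in> I" by (rule sum[OF mem])
  then show ?thesis using fox_expansion[of f] rank_identity_scalar[OF f] by simp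
qed

theorem theorem3p1:
  fixes n :: nat
  assumes "even n" and "n \<ge> 1"
  shows "(Tid (relfree A_alg n) :: (nat list \<Rightarrow> 'k::field_char_0) set) = T_gen {gen1, gen2 n}
         \<and> (Tid (relfree A_alg n) :: (nat list \<Rightarrow> 'k::field_char_0) set) = Tid (relfree A_alg (n + 1))"
proof -
  have gens: "{gen1, gen2 n} = coeff ` {gen1_fa, gen2_fa n :: 'k fa}"
    by (simp add: gen1_eq gen2_eq)
  \<comment> \<open>Three inclusions form a cycle through the identities of rank \<open>n\<close>,
    the generated T-ideal and the identities of rank \<open>n + 1\<close>, which yields both
    equalities.\<close>
  have "(Tid (relfree A_alg n) :: (nat list \<Rightarrow> 'k) set) \<subseteq> T_gen {gen1, gen2 n}"
    unfolding Tid_relfree gens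
  proof (intro image_subsetI in_T_genI)
    fix f :: "'k fa" and I :: "'k fa set"
    assume "f \<in> {f. rank_identity n f}" "T_ideal I" "{gen1_fa, gen2_fa n} \<subseteq> I"
    then show "f \<in> I" using rank_identity_in_T_ideal[of n f I] assms by simp
  qed
  moreover have "T_gen {gen1, gen2 n} \<subseteq> (Tid (relfree A_alg (n + 1)) :: (nat list \<Rightarrow> 'k) set)"
    unfolding Tid_relfree gens
    by (rule T_gen_subset[OF T_ideal_rank_identity])
      (use rank_identity_gen1 rank_identity_gen2[OF assms(1)] in auto)
  moreover have "(Tid (relfree A_alg (n + 1)) :: (nat list \<Rightarrow> 'k) set) \<subseteq> Tid (relfree A_alg n)"
    unfolding Tid_relfree using rank_identity_mono[of n "n + 1"] by auto
  ultimately show ?thesis by blast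
qed

end
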